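(* Let $d\ge1$ and let $B$ be a centered, isotropic, jointly measurable Gaussian field on $S^d$ with continuous covariance function $\kappa:[-1,1]\to\mathbb R$, $\mathbb E[B_xB_y]=\kappa(\langle x,y\rangle)$, $\kappa(1)=1$. Suppose there exist $C_1,C_2,\alpha,\epsilon>0$ such that $|\kappa(t)|<1$ for all $t\neq1$ and $$C_1|\theta|^\alpha\le 1-\kappa(\cos\theta)\le C_2|\theta|^\alpha\qquad\text{for }|\theta|\le\epsilon.$$ Let $\mu$ be the volume measure on $S^d$ and $V(u)=\int_{S^d}\mathbf 1_{\{B_x\ge u\}}\mu(dx)$. Then for every $u\in\mathbb R$ and $p\in\mathbb N$: $V(u)\in\mathbb D^{p,2}$ if and only if $p<d/\alpha+\tfrac12$.
   Context: Hermite polynomials: $H_0=1$, $H_1(x)=x$, $H_{q+1}(x)=xH_q(x)-qH_{q-1}(x)$; $\phi(x)=e^{-x^2/2}/\sqrt{2\pi}$. For $\varphi\in L^2(\mathbb R,\phi(x)dx)$, $a_q(\varphi)=\frac1{q!}\int_{\mathbb R}H_q\varphi\phi\,dx$, and for $Y(\varphi)=\int_{S^d}\varphi(B_x)\mu(dx)$ one says $Y(\varphi)\in\mathbb D^{p,2}$ iff $\sum_{q\ge0}q^p\,q!\,a_q(\varphi)^2\int_{(S^d)^2}\kappa(\langle x,y\rangle)^q\,\mu(dx)\mu(dy)<\infty$. Here $V(u)=Y(\mathbf 1_{[u,\infty)})$. Isotropic means the law of $B$ is invariant under rotations. *)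

theory Defs
  imports "HOL-Probability.Probability"
begin

fun hermite :: "nat \<Rightarrow> real \<Rightarrow> real" where
  "hermite 0 x = 1"
| "hermite (Suc 0) x = x"
| "hermite (Suc (Suc q)) x = x * hermite (Suc q) x - real (Suc q) * hermite q x"

definition hermite_coeff :: "nat \<Rightarrow> (real \<Rightarrow> real) \<Rightarrow> real" where
  "hermite_coeff q \<phi> = (1 / fact q) * (\<integral>x. hermite q x * \<phi> x * std_normal_density x \<partial>lborel)"

text \<open>Volume (surface) measure on the unit sphere of a Euclidean space:
  sigma(A) = DIM * Lebesgue measure of the cone {r x : 0 < r <= 1, x in A}.\<close>
definition sphere_measure :: "'a::euclidean_space measure" where
  "sphere_measure = measure_of (sphere 0 1) (sets (restrict_space borel (sphere (0::'a) 1)))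
     (\<lambda>A. of_nat DIM('a) * emeasure lborel {r *\<^sub>R x | r x. 0 < r \<and> r \<le> 1 \<and> x \<in> A})"

text \<open>Membership of Y(phi) = int phi(B_x) mu(dx) in D^{p,2}, via the chaos criterion
  sum_q q^p q! a_q(phi)^2 int int kappa(<x,y>)^q mu(dx) mu(dy) < infinity.\<close>
definition Y_in_Dp2 :: "(real \<Rightarrow> real) \<Rightarrow> 'a::euclidean_space measure \<Rightarrow> (real \<Rightarrow> real) \<Rightarrow> nat \<Rightarrow> bool" where
  "Y_in_Dp2 \<kappa> \<mu> \<phi> p \<longleftrightarrow>
     summable (\<lambda>q. real q ^ p * fact q * (hermite_coeff q \<phi>)\<^sup>2 *
        (\<integral>x. (\<integral>y. (\<kappa> (x \<bullet> y)) ^ q \<partial>\<mu>) \<partial>\<mu>))"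

text \<open>Centered Gaussian field on a set S with covariance K: every finite linear combination
  sum c_x B_x is a centered (possibly degenerate) Gaussian with variance sum c_x c_y K x y,
  expressed via its characteristic function.\<close>
definition centered_gaussian_field ::
  "'w measure \<Rightarrow> 'a set \<Rightarrow> ('a \<Rightarrow> 'w \<Rightarrow> real) \<Rightarrow> ('a \<Rightarrow> 'a \<Rightarrow> real) \<Rightarrow> bool" where
  "centered_gaussian_field M S B K \<longleftrightarrow>
     prob_space M \<and> (\<forall>x\<in>S. B x \<in> borel_measurable M) \<and>
     (\<forall>F c. finite F \<longrightarrow> F \<subseteq> S \<longrightarrow>
        char (distr M borel (\<lambda>\<omega>. \<Sum>x\<in>F. c x * B x \<omega>)) =
        (\<lambda>t. complex_of_real (exp (- (t\<^sup>2 * (\<Sum>x\<in>F. \<Sum>y\<in>F. c x * c y * K x y)) / 2))))"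

definition isotropic_field :: "'w measure \<Rightarrow> ('a::euclidean_space \<Rightarrow> 'w \<Rightarrow> real) \<Rightarrow> bool" where
  "isotropic_field M B \<longleftrightarrow>
     (\<forall>R F. orthogonal_transformation R \<longrightarrow> finite F \<longrightarrow> F \<subseteq> sphere 0 1 \<longrightarrow>
        distr M (PiM F (\<lambda>_. borel)) (\<lambda>\<omega>. \<lambda>x\<in>F. B (R x) \<omega>) =
        distr M (PiM F (\<lambda>_. borel)) (\<lambda>\<omega>. \<lambda>x\<in>F. B x \<omega>))"

end

(* For q >= 1 the chaos coefficient of the indicator is a_q = H_{q-1}(u) phi(u) / q!, so that
   q! a_q^2 is a constant times H_{q-1}(u)^2 / (q-1)! divided by q. The Christoffel-Darboux identity
   turns the partial sums of H_k(u)^2 / k! into an energy of the three-term recurrence, which shows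
   that H_n(u)^2 / n! + H_{n+1}(u)^2 / (n+1)! is of exact order n^(-1/2). On the other side
   |kappa(<x,y>)| <= exp(-c |x-y|^alpha) globally and kappa(<x,y>) >= 1 - C |x-y|^alpha near the
   diagonal, so kappa^q lives on |x-y| ~ q^(-1/alpha) and its double integral is of exact order
   q^(-d/alpha). The chaos series is therefore comparable with the sum of q^(p - 3/2 - d/alpha). *)

theory Submission
  imports Defs
begin

text \<open>The Hermite obstacle is that a single value H_n(u) can vanish or be small, so it has no
  usable lower bound. The energy identity controls only the sum of two consecutive normalized
  squares. This suffices because the remaining weights q^(p - 1 - d/\<alpha>) vary slowly. The
  identity has relative error O(n^(-1/2)), which perturbs the logarithmic increments of the partial
  sums by O(n^(-3/2)). These errors are summable, so the order of growth is fixed up to constants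
  without any oscillatory asymptotics.

  The kernel obstacle is sign: \<kappa> may be negative away from the diagonal, so odd powers can
  lower the double integral. Since |\<kappa>| < 1 on the compact parts of [-1, 1] that avoid 1, this
  loss is exponentially small in q.

  The surface measure is given by cones, so the mass of a cap is compared with Lebesgue volumes of
  balls strung along the axis of its cone. The dimension d of the sphere is \<open>DIM\<close> minus
  one. At p = d/\<alpha> + 1/2 the comparison series is harmonic, hence the strict
  inequality.\<close>

subsection \<open>Caps of the sphere\<close>

text \<open>The set function given to \<open>measure_of\<close> determines \<open>emeasure\<close>
  only once it is known to be a measure. The cone over a set is its preimage under radial projection
  of the punctured ball, so a push-forward of Lebesgue measure supplies countable
  additivity.\<close>

lemma sphere_measure_eq_scaled_distr:
  "(sphere_measure :: 'a::euclidean_space measure) =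
     scale_measure (of_nat DIM('a)) (distr (restrict_space lborel (cball 0 1 - {0}))
       (restrict_space borel (sphere 0 1)) (\<lambda>z. z /\<^sub>R norm z))"
    (is "_ = scale_measure _ ?N")
  and measurable_radial_projection:
  "(\<lambda>z::'a::euclidean_space. z /\<^sub>R norm z) \<in>
     restrict_space lborel (cball 0 1 - {0}) \<rightarrow>\<^sub>M restrict_space borel (sphere 0 1)"
proof -
  show meas: "(\<lambda>z::'a. z /\<^sub>R norm z) \<in>
     restrict_space lborel (cball 0 1 - {0}) \<rightarrow>\<^sub>M restrict_space borel (sphere 0 1)"
    by (rule measurable_restrict_space2)
      (auto simp: space_restrict_space intro!: measurable_restrict_space1 borel_measurable_scaleR)
  let ?S = "sphere (0::'a) 1" and ?B = "cball (0::'a) 1 - {0}"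
  have sp: "space ?N = ?S" by (simp add: space_restrict_space)
  have sub: "sets (restrict_space borel ?S) \<subseteq> Pow ?S"
    using sets.space_closed[of "restrict_space borel ?S"] by (simp add: space_restrict_space)
  have "of_nat DIM('a) * emeasure lborel {r *\<^sub>R x | r x. 0 < r \<and> r \<le> 1 \<and> x \<in> A} =
      emeasure (scale_measure (of_nat DIM('a)) ?N) A"
    if "A \<in> sigma_sets ?S (sets (restrict_space borel ?S))" for A
  proof -
    have A: "A \<in> sets (restrict_space borel ?S)"
      using that sets.sigma_sets_eq[of "restrict_space borel ?S"] by (simp add: space_restrict_space)
    have AS: "A \<subseteq> ?S" using A sub by auto
    have "(\<lambda>z. z /\<^sub>R norm z) -` A \<inter> ?B = {r *\<^sub>R x | r x. 0 < r \<and> r \<le> 1 \<and> x \<in> A}"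
    proof safe
      fix z :: 'a assume "z /\<^sub>R norm z \<in> A" "z \<in> cball 0 1" "z \<noteq> 0"
      then show "\<exists>r x. z = r *\<^sub>R x \<and> 0 < r \<and> r \<le> 1 \<and> x \<in> A"
        by (intro exI[of _ "norm z"] exI[of _ "z /\<^sub>R norm z"]) auto
    qed (use AS in auto)
    moreover have "emeasure (restrict_space lborel ?B) {r *\<^sub>R x | r x. 0 < r \<and> r \<le> 1 \<and> x \<in> A} =
        emeasure lborel {r *\<^sub>R x | r x. 0 < r \<and> r \<le> 1 \<and> x \<in> A}"
      using AS by (intro emeasure_restrict_space) auto
    ultimately show ?thesis
      using A by (simp add: emeasure_distr[OF meas] space_restrict_space)
  qed
  then have "sphere_measure = measure_of ?S (sets (restrict_space borel ?S))
      (emeasure (scale_measure (of_nat DIM('a)) ?N))"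
    unfolding sphere_measure_def by (intro measure_of_eq sub)
  also have "\<dots> = measure_of (space (scale_measure (of_nat DIM('a)) ?N))
      (sets (scale_measure (of_nat DIM('a)) ?N)) (emeasure (scale_measure (of_nat DIM('a)) ?N))"
    by (simp add: space_scale_measure sp)
  finally show "sphere_measure = scale_measure (of_nat DIM('a)) ?N"
    by (simp only: measure_of_of_measure)
qed

lemma space_sphere_measure [simp]: "space sphere_measure = sphere 0 1"
  by (simp add: sphere_measure_eq_scaled_distr space_scale_measure space_restrict_space)

lemma sets_sphere_measure [measurable_cong]:
  "sets sphere_measure = sets (restrict_space borel (sphere 0 1))"
  by (simp add: sphere_measure_eq_scaled_distr)

lemma emeasure_sphere_measure:
  fixes A :: "'a::euclidean_space set"
  assumes "A \<in> sets sphere_measure"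
  shows "emeasure sphere_measure A =
    of_nat DIM('a) * emeasure lborel {z. z \<noteq> 0 \<and> norm z \<le> 1 \<and> z /\<^sub>R norm z \<in> A}"
proof -
  have "(\<lambda>z::'a. z /\<^sub>R norm z) -` A \<inter> (cball 0 1 - {0}) = {z. z \<noteq> 0 \<and> norm z \<le> 1 \<and> z /\<^sub>R norm z \<in> A}"
    by auto
  moreover have "emeasure (restrict_space lborel (cball 0 1 - {0}))
      {z::'a. z \<noteq> 0 \<and> norm z \<le> 1 \<and> z /\<^sub>R norm z \<in> A} =
      emeasure lborel {z. z \<noteq> 0 \<and> norm z \<le> 1 \<and> z /\<^sub>R norm z \<in> A}"
    by (rule emeasure_restrict_space) auto
  ultimately show ?thesis
    using assms unfolding sphere_measure_eq_scaled_distr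
    by (simp add: emeasure_distr[OF measurable_radial_projection] space_restrict_space)
qed

lemma finite_measure_sphere_measure: "finite_measure (sphere_measure :: 'a::euclidean_space measure)"
proof
  have "emeasure lborel {z::'a. z \<noteq> 0 \<and> norm z \<le> 1 \<and> z /\<^sub>R norm z \<in> sphere 0 1} \<le> emeasure lborel (cball (0::'a) 1)"
    by (intro emeasure_mono) auto
  also have "\<dots> < \<infinity>" by (intro emeasure_bounded_finite) auto
  finally show "emeasure sphere_measure (space sphere_measure :: 'a set) \<noteq> \<infinity>"
    using emeasure_sphere_measure[OF sets.top, where 'a = 'a]
    by (auto simp: ennreal_mult_eq_top_iff)
qed

lemma sphere_cap_in_sets [measurable]:
  "{y \<in> sphere 0 1. dist x y \<le> r} \<in> sets sphere_measure"
proof -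
  have "{y. dist x y \<le> r} \<in> sets borel" by simp
  then have "sphere 0 1 \<inter> {y. dist x y \<le> r} \<in> sets (restrict_space borel (sphere 0 1))"
    by (auto simp: sets_restrict_space)
  then show ?thesis by (simp add: sets_sphere_measure Int_def)
qed

text \<open>The cone over a cap of radius \<open>r\<close> is covered by about \<open>1 / r\<close> balls of radius \<open>2 r\<close> centred
  on its axis.\<close>

lemma emeasure_sphere_cap_le:
  fixes x :: "'a::euclidean_space"
  assumes x: "x \<in> sphere 0 1" and r: "0 < r"
  shows "emeasure sphere_measure {y \<in> sphere 0 1. dist x y \<le> r}
    \<le> ennreal (DIM('a) * (2 * 2 ^ DIM('a) * unit_ball_vol DIM('a)) * r ^ (DIM('a) - 1))"
proof -
  let ?n = "DIM('a)" and ?v = "unit_ball_vol DIM('a)"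
  let ?C = "{z::'a. z \<noteq> 0 \<and> norm z \<le> 1 \<and> z /\<^sub>R norm z \<in> {y \<in> sphere 0 1. dist x y \<le> r}}"
  have v: "?v \<ge> 0" by simp
  have n: "?n \<ge> 1" by (simp add: Suc_le_eq)
  have rn: "r ^ ?n = r * r ^ (?n - 1)" using n by (metis power_eq_if not_one_le_zero)
  have "emeasure lborel ?C \<le> ennreal (2 * 2 ^ ?n * ?v * r ^ (?n - 1))"
  proof (cases "r \<le> 1")
    case True
    \<comment> \<open>A point of the cone at height t <= 1 is assigned to the ball of index floor(t
      / r). The indices run from 0 to floor(1 / r), hence the added 1.\<close>
    define N where "N = nat \<lfloor>1 / r\<rfloor> + 1"
    have N: "real N \<le> 2 / r"
    proof -
      have "real N \<le> 1 / r + 1" using r by (simp add: N_def)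
      also have "\<dots> \<le> 2 / r" using r True by (simp add: field_simps)
      finally show ?thesis .
    qed
    have "?C \<subseteq> (\<Union>j\<in>{..<N}. cball ((real j * r) *\<^sub>R x) (2 * r))"
    proof
      fix z assume "z \<in> ?C"
      then have z: "z \<noteq> 0" "norm z \<le> 1" "dist x (z /\<^sub>R norm z) \<le> r" by auto
      define t where "t = norm z"
      define j where "j = nat \<lfloor>t / r\<rfloor>"
      have t: "0 < t" "t \<le> 1" using z by (auto simp: t_def)
      have "t / r \<le> 1 / r" using t r by (simp add: divide_right_mono)
      then have jN: "j < N" by (simp add: j_def N_def nat_mono floor_mono less_Suc_eq_le)
      have "real j \<le> t / r" "t / r < real j + 1" using t r by (simp_all add: j_def)
      then have jr: "\<bar>real j * r - t\<bar> \<le> r" using r by (simp add: field_simps abs_le_iff)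
      have "dist (t *\<^sub>R x) z = t * dist x (z /\<^sub>R norm z)"
      proof -
        have "z = t *\<^sub>R (z /\<^sub>R norm z)" using z by (simp add: t_def)
        then have "dist (t *\<^sub>R x) z = norm (t *\<^sub>R (x - z /\<^sub>R norm z))"
          by (metis dist_norm scaleR_diff_right)
        then show ?thesis using t by (simp add: dist_norm)
      qed
      also have "\<dots> \<le> 1 * r" using z t r by (intro mult_mono) auto
      finally have 1: "dist (t *\<^sub>R x) z \<le> r" by simp
      have "dist ((real j * r) *\<^sub>R x) (t *\<^sub>R x) = \<bar>real j * r - t\<bar> * norm x"
        by (metis dist_norm norm_scaleR scaleR_left_diff_distrib)
      then have "dist ((real j * r) *\<^sub>R x) (t *\<^sub>R x) \<le> r" using jr x by simp
      with 1 have "dist ((real j * r) *\<^sub>R x) z \<le> 2 * r"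
        using dist_triangle[of "(real j * r) *\<^sub>R x" z "t *\<^sub>R x"] by simp
      then show "z \<in> (\<Union>j\<in>{..<N}. cball ((real j * r) *\<^sub>R x) (2 * r))" using jN by auto
    qed
    then have "emeasure lborel ?C \<le> emeasure lborel (\<Union>j\<in>{..<N}. cball ((real j * r) *\<^sub>R x) (2 * r))"
      by (intro emeasure_mono) auto
    also have "\<dots> \<le> (\<Sum>j<N. emeasure lborel (cball ((real j * r) *\<^sub>R x) (2 * r)))"
      by (intro emeasure_subadditive_finite) auto
    also have "\<dots> = ennreal (real N * (?v * (2 * r) ^ ?n))"
      using r by (simp add: emeasure_cball ennreal_mult ennreal_of_nat_eq_real_of_nat)
    also have "\<dots> \<le> ennreal (2 / r * (?v * (2 * r) ^ ?n))"
      using N r v by (intro ennreal_leI mult_right_mono) auto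
    also have "2 / r * (?v * (2 * r) ^ ?n) = 2 * 2 ^ ?n * ?v * r ^ (?n - 1)"
      using r by (simp add: power_mult_distrib rn)
    finally show ?thesis .
  next
    case False
    \<comment> \<open>For r > 1 the bound already exceeds the volume of the unit ball.\<close>
    have "emeasure lborel ?C \<le> emeasure lborel (cball (0::'a) 1)"
      by (intro emeasure_mono) auto
    also have "\<dots> = ennreal (1 * ?v * 1)" by (simp add: emeasure_cball)
    also have "\<dots> \<le> ennreal (2 * 2 ^ ?n * ?v * r ^ (?n - 1))"
    proof (intro ennreal_leI mult_mono)
      show "(1::real) \<le> 2 * 2 ^ ?n" using one_le_power[of "2::real" ?n] by linarith
    qed (use False in auto)
    finally show ?thesis .
  qed
  then have "of_nat ?n * emeasure lborel ?C \<le> of_nat ?n * ennreal (2 * 2 ^ ?n * ?v * r ^ (?n - 1))"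
    by (rule mult_left_mono) simp
  also have "\<dots> = ennreal (?n * (2 * 2 ^ ?n * ?v) * r ^ (?n - 1))"
    using r by (simp add: ennreal_of_nat_eq_real_of_nat ennreal_mult[symmetric] mult_ac)
  finally show ?thesis by (simp only: emeasure_sphere_measure[OF sphere_cap_in_sets])
qed

text \<open>Conversely, the cone contains about \<open>1 / r\<close> disjoint balls of radius \<open>r / 8\<close> centred on its
  axis.\<close>

lemma emeasure_sphere_cap_ge:
  fixes x :: "'a::euclidean_space"
  assumes x: "x \<in> sphere 0 1" and r: "0 < r" "r \<le> 1"
  shows "ennreal (DIM('a) * unit_ball_vol DIM('a) / 8 ^ DIM('a) * r ^ (DIM('a) - 1))
    \<le> emeasure sphere_measure {y \<in> sphere 0 1. dist x y \<le> r}"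
proof -
  let ?n = "DIM('a)" and ?v = "unit_ball_vol DIM('a)"
  let ?C = "{z::'a. z \<noteq> 0 \<and> norm z \<le> 1 \<and> z /\<^sub>R norm z \<in> {y \<in> sphere 0 1. dist x y \<le> r}}"
  have v: "?v \<ge> 0" by simp
  have n: "?n \<ge> 1" by (simp add: Suc_le_eq)
  have rn: "r ^ ?n = r * r ^ (?n - 1)" using n by (metis power_eq_if not_one_le_zero)
  \<comment> \<open>The number \<open>N\<close> counts the diameters 2 s that fit into the shell 1/2
    <= norm <= 1. With s = r / 8 it is floor(2 / r), which is at least 1 / r because r <= 1.
    Projecting a point of norm at least 1/2 to the sphere at most doubles its distance 2 s from the
    axis point of equal norm, giving 4 s <= r.\<close>
  define s where "s = r / 8"
  define N where "N = nat \<lfloor>1 / (4 * s)\<rfloor>"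
  define t where "t j = 1 / 2 + s + 2 * s * real j" for j
  have s: "0 < s" "s \<le> 1/8" using r by (auto simp: s_def)
  have N: "1 / r \<le> real N" "real N * (4 * s) \<le> 1"
  proof -
    have "1 / (4 * s) = 2 / r" by (simp add: s_def)
    moreover have "real N > 1 / (4 * s) - 1" unfolding N_def using s by linarith
    moreover have "2 / r = 1 / r + 1 / r" "1 \<le> 1 / r" using r by simp_all
    ultimately show "1 / r \<le> real N" by linarith
    have "real N \<le> 1 / (4 * s)" using s by (simp add: N_def)
    then show "real N * (4 * s) \<le> 1" using s by (simp add: field_simps)
  qed
  have C: "?C \<in> sets lborel"
  proof -
    have "?C = {z. z \<noteq> 0 \<and> norm z \<le> 1 \<and> dist x (z /\<^sub>R norm z) \<le> r}" by auto
    then show ?thesis by simp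
  qed
  have sub: "(\<Union>j\<in>{..<N}. ball (t j *\<^sub>R x) s) \<subseteq> ?C"
  proof safe
    fix j z assume j: "j < N" and "z \<in> ball (t j *\<^sub>R x) s"
    then have d: "dist (t j *\<^sub>R x) z < s" by simp
    have "real j + 1 \<le> real N" using j by simp
    then have "(real j + 1) * (4 * s) \<le> real N * (4 * s)" using s by (intro mult_right_mono) auto
    with N have t: "1 / 2 + s \<le> t j" "t j + s \<le> 1" using s by (auto simp: t_def algebra_simps)
    have nt: "norm (t j *\<^sub>R x) = t j" using t s x by simp
    have nz: "\<bar>norm z - t j\<bar> \<le> s"
      using d norm_triangle_ineq3[of z "t j *\<^sub>R x"] unfolding nt by (simp add: dist_norm norm_minus_commute)
    have z: "1/2 \<le> norm z" "norm z \<le> 1" using nz t s by linarith+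
    show "norm z \<le> 1" by fact
    have z0: "z \<noteq> 0" using z by auto
    then show "z /\<^sub>R norm z \<in> sphere 0 1" by simp
    have "dist (norm z *\<^sub>R x) (t j *\<^sub>R x) = \<bar>norm z - t j\<bar> * norm x"
      by (metis dist_norm norm_scaleR scaleR_left_diff_distrib)
    then have "dist (norm z *\<^sub>R x) (t j *\<^sub>R x) \<le> s" using nz x by simp
    then have 1: "dist (norm z *\<^sub>R x) z \<le> 2 * s"
      using d dist_triangle[of "norm z *\<^sub>R x" z "t j *\<^sub>R x"] by simp
    have "z = norm z *\<^sub>R (z /\<^sub>R norm z)" using z0 by simp
    then have "dist (norm z *\<^sub>R x) z = norm z * dist x (z /\<^sub>R norm z)"
      by (metis dist_norm scaleR_diff_right norm_scaleR abs_norm_cancel)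
    moreover have "1/2 * dist x (z /\<^sub>R norm z) \<le> norm z * dist x (z /\<^sub>R norm z)"
      using z by (intro mult_right_mono) auto
    ultimately have "dist x (z /\<^sub>R norm z) \<le> 4 * s" using 1 by linarith
    then show "dist x (z /\<^sub>R norm z) \<le> r" using r by (simp add: s_def)
  next
    fix j assume j: "0 \<in> ball (t j *\<^sub>R x) s"
    have "t j \<ge> s" using s by (simp add: t_def)
    then show False using j x s by simp
  qed
  have disj: "disjoint_family_on (\<lambda>j. ball (t j *\<^sub>R x) s) {..<N}"
    unfolding disjoint_family_on_def
  proof safe
    fix i j z assume ij: "i \<noteq> j" and "z \<in> ball (t i *\<^sub>R x) s" "z \<in> ball (t j *\<^sub>R x) s"
    then have "dist (t i *\<^sub>R x) (t j *\<^sub>R x) < 2 * s"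
      using dist_triangle2[of "t i *\<^sub>R x" "t j *\<^sub>R x" z] by simp
    moreover have "dist (t i *\<^sub>R x) (t j *\<^sub>R x) = \<bar>t i - t j\<bar> * norm x"
      by (metis dist_norm norm_scaleR scaleR_left_diff_distrib)
    ultimately have "\<bar>t i - t j\<bar> < 2 * s" using x by simp
    moreover have "t i - t j = 2 * s * (real i - real j)" by (simp add: t_def algebra_simps)
    ultimately have "2 * s * \<bar>real i - real j\<bar> < 2 * s * 1" using s by (simp add: abs_mult)
    then have "\<bar>real i - real j\<bar> < 1" using s by (simp only: mult_less_cancel_left_pos)
    then have False using ij by linarith
    then show "z \<in> {}" ..
  qed
  have "ennreal (?v / 8 ^ ?n * r ^ (?n - 1)) = ennreal (1 / r * (?v * s ^ ?n))"
    using r by (simp add: s_def power_divide rn)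
  also have "\<dots> \<le> ennreal (real N * (?v * s ^ ?n))"
    using N s v by (intro ennreal_leI mult_right_mono) auto
  also have "\<dots> = (\<Sum>j<N. emeasure lborel (ball (t j *\<^sub>R x) s))"
    using s by (simp add: emeasure_ball ennreal_mult ennreal_of_nat_eq_real_of_nat)
  also have "\<dots> = emeasure lborel (\<Union>j\<in>{..<N}. ball (t j *\<^sub>R x) s)"
    using disj by (intro sum_emeasure) auto
  also have "\<dots> \<le> emeasure lborel ?C"
    using sub C by (rule emeasure_mono)
  finally have "of_nat ?n * ennreal (?v / 8 ^ ?n * r ^ (?n - 1)) \<le> of_nat ?n * emeasure lborel ?C"
    by (rule mult_left_mono) simp
  moreover have "of_nat ?n * ennreal (?v / 8 ^ ?n * r ^ (?n - 1)) = ennreal (?n * ?v / 8 ^ ?n * r ^ (?n - 1))"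
    using r by (simp add: ennreal_of_nat_eq_real_of_nat ennreal_mult[symmetric] mult_ac)
  ultimately show ?thesis by (simp only: emeasure_sphere_measure[OF sphere_cap_in_sets])
qed

subsection \<open>Powers of a kernel peaked on the diagonal\<close>

lemma summable_power_mult_exp_powr:
  fixes c \<alpha> :: real
  assumes "c > 0" "\<alpha> > 0"
  shows "summable (\<lambda>k. real (k + 1) ^ d * exp (- (c * real k powr \<alpha>)))"
proof (rule summable_comparison_test_bigo)
  have "(\<lambda>k. real (k + 1) ^ d) \<in> O(\<lambda>k. real k powr real d)"
  proof (rule bigoI[of _ "2 ^ d"], rule eventually_mono[OF eventually_gt_at_top[of 0]])
    fix k :: nat assume k: "0 < k"
    then have "real (k + 1) ^ d \<le> (2 * real k) ^ d" by (intro power_mono) auto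
    then show "norm (real (k + 1) ^ d) \<le> 2 ^ d * norm (real k powr real d)"
      using k by (simp add: powr_realpow power_mult_distrib)
  qed
  \<comment> \<open>The exponent cancels the polynomial factor of degree d and leaves
    k^(-2).\<close>
  moreover have "(\<lambda>k. exp (- (c * real k powr \<alpha>))) \<in> O(\<lambda>k. real k powr (- 2 - real d))"
    using assms by real_asymp
  ultimately have "(\<lambda>k. real (k + 1) ^ d * exp (- (c * real k powr \<alpha>))) \<in>
      O(\<lambda>k. real k powr real d * real k powr (- 2 - real d))"
    by (rule landau_o.big.mult)
  then show "(\<lambda>k. real (k + 1) ^ d * exp (- (c * real k powr \<alpha>))) \<in> O(\<lambda>k. real k powr - 2)"
    by (simp flip: powr_add)
  show "summable (\<lambda>k. norm (real k powr - 2))" by (simp add: summable_real_powr_iff)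
qed

text \<open>The shells \<open>k s \<le> g < (k + 1) s\<close> at the scale \<open>s = q powr (-1/\<alpha>)\<close> contribute at most
  \<open>exp (- c k powr \<alpha>) * K ((k + 1) s) ^ d\<close> each.\<close>

lemma nn_integral_exp_powr_le:
  fixes g :: "'b \<Rightarrow> real"
  assumes g [measurable]: "g \<in> borel_measurable M" and g0: "\<And>x. x \<in> space M \<Longrightarrow> 0 \<le> g x"
    and vol: "\<And>r. r > 0 \<Longrightarrow> emeasure M {x \<in> space M. g x \<le> r} \<le> ennreal (K * r ^ d)"
    and K: "K \<ge> 0" and c: "c > 0" "\<alpha> > 0" and q: "q > 0"
  shows "(\<integral>\<^sup>+x. ennreal (exp (- (c * q * g x powr \<alpha>))) \<partial>M) \<le>
    ennreal (K * (\<Sum>k. real (k + 1) ^ d * exp (- (c * real k powr \<alpha>))) * q powr (- (real d / \<alpha>)))"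
proof -
  define s where "s = q powr (- (1 / \<alpha>))"
  have s: "s > 0" using q by (simp add: s_def)
  have sq: "s powr \<alpha> = 1 / q" using c q by (simp add: s_def powr_powr powr_neg_one)
  have sd: "s ^ d = q powr (- (real d / \<alpha>))"
    using s by (simp add: s_def powr_powr flip: powr_realpow)
  \<comment> \<open>Only sublevel sets have a volume bound, so each shell is enlarged to the full
    sublevel set that contains it; the exponential weights keep the overcounted sum finite.\<close>
  let ?A = "\<lambda>k. {x \<in> space M. g x \<le> real (k + 1) * s}"
  have term_le_suminf: "F k \<le> suminf F" for F :: "nat \<Rightarrow> ennreal" and k
    using sum_le_suminf[of F "{k}"] by simp
  have "(\<integral>\<^sup>+x. ennreal (exp (- (c * q * g x powr \<alpha>))) \<partial>M) \<le>
      (\<integral>\<^sup>+x. (\<Sum>k. ennreal (exp (- (c * real k powr \<alpha>))) * indicator (?A k) x) \<partial>M)"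
  proof (intro nn_integral_mono)
    fix x assume x: "x \<in> space M"
    define k where "k = nat \<lfloor>g x / s\<rfloor>"
    have k: "real k \<le> g x / s" "g x / s \<le> real (k + 1)"
      using g0[OF x] s real_of_int_floor_add_one_ge[of "g x / s"] by (auto simp: k_def add.commute)
    have "real k powr \<alpha> \<le> (g x / s) powr \<alpha>" using k c by (intro powr_mono2) auto
    also have "\<dots> = q * g x powr \<alpha>" using g0[OF x] s q by (simp add: powr_divide sq)
    finally have "exp (- (c * q * g x powr \<alpha>)) \<le> exp (- (c * real k powr \<alpha>))"
      using c by (simp add: mult.assoc)
    moreover have "x \<in> ?A k" using x k s by (simp add: field_simps)
    ultimately have "ennreal (exp (- (c * q * g x powr \<alpha>))) \<le>
        ennreal (exp (- (c * real k powr \<alpha>))) * indicator (?A k) x"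
      by (simp add: ennreal_leI)
    also have "\<dots> \<le> (\<Sum>k. ennreal (exp (- (c * real k powr \<alpha>))) * indicator (?A k) x)"
      by (rule term_le_suminf)
    finally show "ennreal (exp (- (c * q * g x powr \<alpha>))) \<le>
        (\<Sum>k. ennreal (exp (- (c * real k powr \<alpha>))) * indicator (?A k) x)" .
  qed
  also have "\<dots> = (\<Sum>k. ennreal (exp (- (c * real k powr \<alpha>))) * emeasure M (?A k))"
    by (subst nn_integral_suminf) (simp_all add: nn_integral_cmult_indicator)
  also have "\<dots> \<le> (\<Sum>k. ennreal (K * s ^ d * (real (k + 1) ^ d * exp (- (c * real k powr \<alpha>)))))"
  proof (intro suminf_le allI)
    fix k
    have "ennreal (exp (- (c * real k powr \<alpha>))) * emeasure M (?A k) \<le>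
       ennreal (exp (- (c * real k powr \<alpha>))) * ennreal (K * (real (k + 1) * s) ^ d)"
      using s by (intro mult_left_mono vol) auto
    also have "\<dots> = ennreal (K * s ^ d * (real (k + 1) ^ d * exp (- (c * real k powr \<alpha>))))"
      using s K by (subst ennreal_mult[symmetric]) (auto simp: power_mult_distrib mult_ac)
    finally show "ennreal (exp (- (c * real k powr \<alpha>))) * emeasure M (?A k) \<le> \<dots>" .
  qed auto
  also have "\<dots> = ennreal (\<Sum>k. K * s ^ d * (real (k + 1) ^ d * exp (- (c * real k powr \<alpha>))))"
    using s K c by (intro suminf_ennreal2 summable_mult summable_power_mult_exp_powr) auto
  also have "(\<Sum>k. K * s ^ d * (real (k + 1) ^ d * exp (- (c * real k powr \<alpha>)))) =
      K * s ^ d * (\<Sum>k. real (k + 1) ^ d * exp (- (c * real k powr \<alpha>)))"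
    using c by (intro suminf_mult summable_power_mult_exp_powr)
  finally show ?thesis by (simp add: sd mult_ac)
qed

text \<open>Both bounds come from inner integrals estimated uniformly in x, so the outer integration
  only contributes the total mass. The upper bound sums shells of \<open>dist x\<close>. The lower
  bound keeps one cap of radius of order q^(-1/\<alpha>), where the q-th power stays above 1/2, and
  pays for possible negative values far from x with an exponentially small term.\<close>

lemma sphere_kernel_power_integral_asymp:
  fixes f :: "'a::euclidean_space \<Rightarrow> 'a \<Rightarrow> real" and c C \<alpha> r\<^sub>0 :: real
  defines "\<sigma> \<equiv> sphere_measure :: 'a measure" and "D \<equiv> (real DIM('a) - 1) / \<alpha>"
  assumes meas: "(\<lambda>(x, y). f x y) \<in> borel_measurable (\<sigma> \<Otimes>\<^sub>M \<sigma>)"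
    and up: "\<And>x y. x \<in> sphere 0 1 \<Longrightarrow> y \<in> sphere 0 1 \<Longrightarrow> \<bar>f x y\<bar> \<le> exp (- (c * dist x y powr \<alpha>))"
    and low: "\<And>x y. x \<in> sphere 0 1 \<Longrightarrow> y \<in> sphere 0 1 \<Longrightarrow> dist x y \<le> r\<^sub>0 \<Longrightarrow> 1 - C * dist x y powr \<alpha> \<le> f x y"
    and pos: "c > 0" "C > 0" "\<alpha> > 0" "r\<^sub>0 > 0"
  shows "\<exists>a b. a > 0 \<and> b > 0 \<and> (\<forall>\<^sub>F q in sequentially.
    a * real q powr - D \<le> (\<integral>x. (\<integral>y. f x y ^ q \<partial>\<sigma>) \<partial>\<sigma>) \<and>
    (\<integral>x. (\<integral>y. f x y ^ q \<partial>\<sigma>) \<partial>\<sigma>) \<le> b * real q powr - D)"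
proof -
  let ?n = "DIM('a)"
  have n: "real (?n - 1) = real ?n - 1" by (simp add: of_nat_diff Suc_le_eq)
  interpret \<sigma>: finite_measure \<sigma> unfolding \<sigma>_def by (rule finite_measure_sphere_measure)
  have sp: "space \<sigma> = sphere 0 1" by (simp add: \<sigma>_def)
  have id [measurable]: "(\<lambda>x. x) \<in> \<sigma> \<rightarrow>\<^sub>M borel"
    unfolding \<sigma>_def by (subst measurable_cong_sets[OF sets_sphere_measure refl]) (rule measurable_restrict_space1, simp)
  have meas_y: "(\<lambda>y. f x y) \<in> borel_measurable \<sigma>" if "x \<in> sphere 0 1" for x
    using measurable_Pair2[OF meas, of x] that by (simp add: sp)
  have cap_set [measurable]: "{y \<in> sphere 0 1. dist x y \<le> r} \<in> sets \<sigma>" for x r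
    unfolding \<sigma>_def by (rule sphere_cap_in_sets)
  have f_le1: "\<bar>f x y\<bar> \<le> 1" if "x \<in> sphere 0 1" "y \<in> sphere 0 1" for x y
    using up[OF that] pos by (smt (verit) exp_le_one_iff mult_nonneg_nonneg powr_ge_zero)
  have int_y: "integrable \<sigma> (\<lambda>y. f x y ^ q)" if "x \<in> sphere 0 1" for x q
  proof (rule \<sigma>.integrable_const_bound[where B = 1])
    show "AE y in \<sigma>. norm (f x y ^ q) \<le> 1"
      using f_le1[OF that] by (intro AE_I2) (auto simp: sp power_abs intro: power_le_one)
    show "(\<lambda>y. f x y ^ q) \<in> borel_measurable \<sigma>" using meas_y[OF that] by measurable
  qed
  define V where "V = measure \<sigma> (sphere 0 1)"
  define J where "J q x = (\<integral>y. f x y ^ q \<partial>\<sigma>)" for q x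
  have meas_J [measurable]: "J q \<in> borel_measurable \<sigma>" for q
    unfolding J_def using meas by (intro \<sigma>.borel_measurable_lebesgue_integral) (simp add: case_prod_unfold)
  define A where "A = ?n * (2 * 2 ^ ?n * unit_ball_vol ?n)"
  define B where "B = ?n * unit_ball_vol ?n / 8 ^ ?n"
  have A: "A \<ge> 0" and B: "B > 0" by (auto simp: A_def B_def)
  have cap_le: "emeasure \<sigma> {y \<in> sphere 0 1. dist x y \<le> r} \<le> ennreal (A * r ^ (?n - 1))"
    if "x \<in> sphere 0 1" "r > 0" for x r
    using emeasure_sphere_cap_le[OF that] by (simp add: A_def \<sigma>_def)
  have cap_ge: "B * r ^ (?n - 1) \<le> measure \<sigma> {y \<in> sphere 0 1. dist x y \<le> r}"
    if "x \<in> sphere 0 1" "r > 0" "r \<le> 1" for x r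
    using emeasure_sphere_cap_ge[OF that] B that
    by (simp add: B_def \<sigma>.emeasure_eq_measure[unfolded \<sigma>_def] \<sigma>_def)
  \<comment> \<open>Any point serves here: the cap around it shows that the total mass is
    positive.\<close>
  obtain e :: 'a where e: "e \<in> sphere 0 1" using vector_choose_size[of 1] by (auto simp: dist_norm)
  have V: "V > 0"
  proof -
    have "B \<le> measure \<sigma> {y \<in> sphere 0 1. dist e y \<le> 1}" using cap_ge[OF e, of 1] by simp
    also have "\<dots> \<le> V" unfolding V_def using sets.top[of \<sigma>] by (intro \<sigma>.finite_measure_mono) (auto simp: sp)
    finally show ?thesis using B by simp
  qed
  define Z where "Z = (\<Sum>k. real (k + 1) ^ (?n - 1) * exp (- (c * real k powr \<alpha>)))"
  have Z: "Z \<ge> 0" unfolding Z_def using pos by (intro suminf_nonneg summable_power_mult_exp_powr) auto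
  have J_le: "\<bar>J q x\<bar> \<le> A * Z * real q powr - D" if q: "q > 0" and x: "x \<in> sphere 0 1" for q x
  proof -
    have "ennreal \<bar>J q x\<bar> \<le> (\<integral>\<^sup>+y. ennreal (norm (f x y ^ q)) \<partial>\<sigma>)"
      unfolding J_def using integral_norm_bound_ennreal[OF int_y[OF x]] by simp
    also have "\<dots> \<le> (\<integral>\<^sup>+y. ennreal (exp (- (c * real q * dist x y powr \<alpha>))) \<partial>\<sigma>)"
    proof (intro nn_integral_mono ennreal_leI)
      fix y assume "y \<in> space \<sigma>"
      then have "\<bar>f x y\<bar> ^ q \<le> exp (- (c * dist x y powr \<alpha>)) ^ q"
        using x by (intro power_mono up) (auto simp: sp)
      then show "norm (f x y ^ q) \<le> exp (- (c * real q * dist x y powr \<alpha>))"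
        by (simp add: power_abs mult_ac flip: exp_of_nat_mult)
    qed
    also have "\<dots> \<le> ennreal (A * Z * real q powr - (real (?n - 1) / \<alpha>))"
      unfolding Z_def using pos q A x cap_le
      by (intro nn_integral_exp_powr_le) (auto simp: sp)
    finally show ?thesis using A Z by (simp add: D_def n)
  qed
  have int_J: "integrable \<sigma> (J q)" if q: "q > 0" for q
    using J_le[OF q] by (intro \<sigma>.integrable_const_bound[where B = "A * Z * real q powr - D"] AE_I2) (auto simp: sp)
  \<comment> \<open>Only \<open>A * Z\<close> >= 0 is known; the added 1 makes the constant strictly
    positive.\<close>
  have up_I: "(\<integral>x. J q x \<partial>\<sigma>) \<le> V * (A * Z + 1) * real q powr - D" if q: "q > 0" for q
  proof -
    have "(\<integral>x. J q x \<partial>\<sigma>) \<le> (\<integral>x. A * Z * real q powr - D \<partial>\<sigma>)"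
      using J_le[OF q] by (intro integral_mono int_J q) (auto simp: sp abs_le_iff)
    also have "\<dots> = V * (A * Z) * real q powr - D" by (simp add: V_def sp)
    also have "\<dots> \<le> V * (A * Z + 1) * real q powr - D" using V by (intro mult_right_mono mult_left_mono) auto
    finally show ?thesis .
  qed
  \<comment> \<open>Within this radius the local lower bound applies and is nonnegative, so
    \<open>f\<close> can be negative only at distances above \<open>r\<close>.\<close>
  define r where "r = min r\<^sub>0 ((1 / C) powr (1 / \<alpha>))"
  have r: "0 < r" "r \<le> r\<^sub>0" using pos by (auto simp: r_def)
  have Cr: "C * r powr \<alpha> \<le> 1"
  proof -
    have "r powr \<alpha> \<le> ((1 / C) powr (1 / \<alpha>)) powr \<alpha>" using pos r by (intro powr_mono2) (auto simp: r_def)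
    also have "\<dots> = 1 / C" using pos by (simp add: powr_powr)
    finally show ?thesis using pos by (simp add: field_simps)
  qed
  define \<eta> where "\<eta> = c * r powr \<alpha>"
  have \<eta>: "\<eta> > 0" using pos r by (simp add: \<eta>_def)
  \<comment> \<open>Since C \<delta>^\<alpha> = 1/2, the radius s = \<delta> q^(-1/\<alpha>)
    satisfies C s^\<alpha> = 1/(2 q), and Bernoulli's inequality gives (1 - 1/(2 q))^q >= 1/2 on the
    cap.\<close>
  define \<delta> where "\<delta> = (1 / (2 * C)) powr (1 / \<alpha>)"
  have \<delta>: "\<delta> > 0" "C * \<delta> powr \<alpha> = 1 / 2" using pos by (auto simp: \<delta>_def powr_powr)
  have low_J: "1 / 2 * (B * s ^ (?n - 1)) - exp (- (\<eta> * real q)) * V \<le> J q x"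
    if q: "q > 0" and x: "x \<in> sphere 0 1" and s: "s = \<delta> * real q powr - (1 / \<alpha>)" "s \<le> r" "s \<le> 1" for q x s
  proof -
    have s0: "s > 0" using \<delta> q by (simp add: s)
    have Cs: "C * s powr \<alpha> = 1 / (2 * real q)"
    proof -
      have "C * s powr \<alpha> = (C * \<delta> powr \<alpha>) * (real q powr - (1 / \<alpha>)) powr \<alpha>"
        using \<delta> q by (simp add: s powr_mult)
      also have "(real q powr - (1 / \<alpha>)) powr \<alpha> = 1 / real q"
        using pos q by (simp add: powr_powr powr_neg_one)
      finally show ?thesis by (simp add: \<delta>)
    qed
    \<comment> \<open>One inequality covers three zones: the small cap, the annulus up to
      \<open>r\<close> where \<open>f\<close> is nonnegative, and the far zone where |f|^q <=
      exp(-\<eta> q). The exponential is subtracted everywhere so that the bound can be integrated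
      at once.\<close>
    have pt: "1 / 2 * indicator {y \<in> sphere 0 1. dist x y \<le> s} y - exp (- (\<eta> * real q)) \<le> f x y ^ q"
      if y: "y \<in> sphere 0 1" for y
    proof (cases "dist x y \<le> r")
      case True
      have ge: "1 - C * dist x y powr \<alpha> \<le> f x y" using low x y True r by simp
      show ?thesis
      proof (cases "dist x y \<le> s")
        case True
        have "C * dist x y powr \<alpha> \<le> C * s powr \<alpha>" using True pos by (intro mult_left_mono powr_mono2) auto
        then have "1 - 1 / (2 * real q) \<le> f x y" using ge Cs by simp
        moreover have q1: "1 / (2 * real q) \<le> 1" using q by (simp add: field_simps)
        ultimately have "(1 - 1 / (2 * real q)) ^ q \<le> f x y ^ q" by (intro power_mono) auto
        moreover have "1 + real q * (- (1 / (2 * real q))) \<le> (1 + - (1 / (2 * real q))) ^ q"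
          using q1 by (intro Bernoulli_inequality) auto
        ultimately have "1 / 2 \<le> f x y ^ q" using q by simp
        moreover have "exp (- (\<eta> * real q)) \<ge> 0" by simp
        ultimately have "1 / 2 - exp (- (\<eta> * real q)) \<le> f x y ^ q" by linarith
        then show ?thesis using True y by simp
      next
        case False
        have "C * dist x y powr \<alpha> \<le> C * r powr \<alpha>"
          using \<open>dist x y \<le> r\<close> pos by (intro mult_left_mono powr_mono2) auto
        then have "f x y \<ge> 0" using ge Cr by simp
        then have "f x y ^ q \<ge> 0" by simp
        moreover have "exp (- (\<eta> * real q)) \<ge> 0" by simp
        ultimately have "- exp (- (\<eta> * real q)) \<le> f x y ^ q" by linarith
        then show ?thesis using False by simp
      qed
    next
      case False
      have "r powr \<alpha> \<le> dist x y powr \<alpha>" using False r pos by (intro powr_mono2) auto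
      then have "exp (- (c * dist x y powr \<alpha>)) \<le> exp (- \<eta>)" using pos by (simp add: \<eta>_def)
      then have "\<bar>f x y\<bar> \<le> exp (- \<eta>)" using up[OF x y] by linarith
      then have "\<bar>f x y\<bar> ^ q \<le> exp (- \<eta>) ^ q" by (intro power_mono) auto
      then have "\<bar>f x y ^ q\<bar> \<le> exp (- (\<eta> * real q))"
        by (simp add: power_abs mult_ac flip: exp_of_nat_mult)
      then have "- exp (- (\<eta> * real q)) \<le> f x y ^ q" by linarith
      moreover have "\<not> dist x y \<le> s" using False s by simp
      ultimately show ?thesis by simp
    qed
    define T where "T = {y \<in> sphere 0 1. dist x y \<le> s}"
    have T: "T \<in> sets \<sigma>" "T \<inter> sphere 0 1 = T"
      unfolding T_def by (rule cap_set) blast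
    have int_T: "integrable \<sigma> (\<lambda>y. 1 / 2 * indicator T y :: real)"
      using T by (intro integrable_mult_right integrable_real_indicator) (auto simp: \<sigma>.emeasure_eq_measure)
    have "1 / 2 * (B * s ^ (?n - 1)) - exp (- (\<eta> * real q)) * V \<le>
        1 / 2 * measure \<sigma> T - exp (- (\<eta> * real q)) * V"
      using cap_ge[OF x s0 s(3)] by (simp add: T_def)
    also have "\<dots> = (\<integral>y. 1 / 2 * indicator T y - exp (- (\<eta> * real q)) \<partial>\<sigma>)"
      using T by (subst Bochner_Integration.integral_diff[OF int_T]) (simp_all add: V_def sp mult.commute)
    also have "\<dots> \<le> J q x"
      unfolding J_def using pt[folded T_def] x
      by (intro integral_mono int_y Bochner_Integration.integrable_diff int_T) (auto simp: sp)
    finally show ?thesis .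
  qed
  \<comment> \<open>The cap contributes 2 a q^(-D); half of it is reserved to absorb the exponential
    error.\<close>
  define a where "a = B * \<delta> ^ (?n - 1) / 4"
  have a: "a > 0" using B \<delta> by (simp add: a_def)
  have ev1: "\<forall>\<^sub>F q in sequentially. \<delta> * real q powr - (1 / \<alpha>) \<le> r"
    "\<forall>\<^sub>F q in sequentially. \<delta> * real q powr - (1 / \<alpha>) \<le> 1"
    using \<delta>(1) r(1) pos(3) by real_asymp+
  have ev2: "\<forall>\<^sub>F q in sequentially. exp (- (\<eta> * real q)) * V \<le> a * real q powr - D"
    using \<eta> V a by real_asymp
  have "\<forall>\<^sub>F q in sequentially. V * a * real q powr - D \<le> (\<integral>x. J q x \<partial>\<sigma>) \<and>
      (\<integral>x. J q x \<partial>\<sigma>) \<le> V * (A * Z + 1) * real q powr - D"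
    using ev1 ev2 eventually_gt_at_top[of "0::nat"]
  proof eventually_elim
    case (elim q)
    define s where "s = \<delta> * real q powr - (1 / \<alpha>)"
    have "s ^ (?n - 1) = \<delta> ^ (?n - 1) * real q powr - D"
      using elim by (simp add: s_def power_mult_distrib powr_powr D_def n flip: powr_realpow)
    then have "1 / 2 * (B * s ^ (?n - 1)) = 2 * a * real q powr - D" by (simp add: a_def)
    then have "a * real q powr - D \<le> J q x" if "x \<in> sphere 0 1" for x
      using low_J[OF _ that s_def] elim by (simp add: s_def)
    then have "(\<integral>x. a * real q powr - D \<partial>\<sigma>) \<le> (\<integral>x. J q x \<partial>\<sigma>)"
      using elim by (intro integral_mono int_J) (auto simp: sp)
    moreover have "(\<integral>x. a * real q powr - D \<partial>\<sigma>) = V * a * real q powr - D"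
      by (simp add: V_def sp)
    ultimately have "V * a * real q powr - D \<le> (\<integral>x. J q x \<partial>\<sigma>)" by (simp only:)
    then show ?case using up_I[of q] elim by simp
  qed
  moreover have "V * a > 0" "V * (A * Z + 1) > 0"
    using V a A Z by (auto intro!: mult_pos_pos add_nonneg_pos)
  ultimately show ?thesis unfolding J_def by blast
qed

subsection \<open>Hermite polynomials\<close>

lemma DERIV_hermite: "(hermite (Suc n) has_real_derivative real (Suc n) * hermite n x) (at x)"
proof (induction n rule: induct_nat_012)
  case (ge2 n)
  have "((\<lambda>x. x * hermite (Suc (Suc n)) x - real (Suc (Suc n)) * hermite (Suc n) x) has_real_derivative
     1 * hermite (Suc (Suc n)) x + real (Suc (Suc n)) * hermite (Suc n) x * x
      - real (Suc (Suc n)) * (real (Suc n) * hermite n x)) (at x)"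
    by (intro DERIV_diff DERIV_mult DERIV_cmult DERIV_ident ge2)
  moreover have "(\<lambda>x. x * hermite (Suc (Suc n)) x - real (Suc (Suc n)) * hermite (Suc n) x) =
      hermite (Suc (Suc (Suc n)))"
    by auto
  ultimately show ?case by (simp add: algebra_simps)
qed (auto intro!: derivative_eq_intros)

lemma isCont_hermite: "isCont (hermite n) x"
proof (cases n)
  case 0
  then have "hermite n = (\<lambda>_. 1)" by auto
  then show ?thesis by simp
qed (use DERIV_hermite DERIV_isCont in blast)

lemma borel_measurable_hermite [measurable]: "hermite n \<in> borel_measurable borel"
  by (intro borel_measurable_continuous_onI continuous_at_imp_continuous_on ballI isCont_hermite)

text \<open>This is Rodrigues' formula, one derivative at a time: H_n' = n H_{n-1} and \<phi>' = -x
  \<phi> combine to x H_n - n H_{n-1}, which the recurrence identifies as H_{n+1}.\<close>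

lemma DERIV_hermite_mult_std_normal_density:
  "((\<lambda>x. - (hermite n x * std_normal_density x)) has_real_derivative
     hermite (Suc n) x * std_normal_density x) (at x)"
proof -
  have d: "(std_normal_density has_real_derivative - x * std_normal_density x) (at x)"
  proof -
    have "((\<lambda>x. 1 / sqrt (2 * pi) * exp (- x\<^sup>2 / 2)) has_real_derivative
        1 / sqrt (2 * pi) * (exp (- x\<^sup>2 / 2) * - x)) (at x)"
      by (intro DERIV_cmult) (auto intro!: derivative_eq_intros)
    then show ?thesis by (simp add: std_normal_density_def[abs_def] mult_ac)
  qed
  show ?thesis
  proof (cases n)
    case 0
    then show ?thesis using DERIV_minus[OF d] by simp
  next
    case (Suc m)
    show ?thesis
      using DERIV_minus[OF DERIV_mult[OF DERIV_hermite[of m x] d]] Suc by (simp add: algebra_simps)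
  qed
qed

text \<open>Through this expansion, integrability and decay against the Gaussian density reduce to
  the case of monomials.\<close>

lemma hermite_eq_poly: "\<exists>c. \<forall>x. hermite n x = (\<Sum>i\<le>n. c i * x ^ i)"
proof (induction n rule: induct_nat_012)
  case 0
  show ?case by (intro exI[of _ "\<lambda>_. 1"]) simp
next
  case 1
  show ?case by (intro exI[of _ "\<lambda>i. if i = 0 then 0 else 1"]) simp
next
  case (ge2 q)
  then obtain a b where a: "\<And>x. hermite (Suc q) x = (\<Sum>i\<le>Suc q. a i * x ^ i)"
    and b: "\<And>x. hermite q x = (\<Sum>i\<le>q. b i * x ^ i)" by blast
  define c where "c i = (if i = 0 then 0 else a (i - 1)) - (if i \<le> q then real (Suc q) * b i else 0)" for i
  have "hermite (Suc (Suc q)) x = (\<Sum>i\<le>Suc (Suc q). c i * x ^ i)" for x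
  proof -
    have "(\<Sum>i\<le>Suc (Suc q). (if i = 0 then 0 else a (i - 1)) * x ^ i) = x * hermite (Suc q) x"
      unfolding a by (subst sum.atMost_Suc_shift) (simp add: sum_distrib_left mult_ac del: sum.atMost_Suc)
    moreover have "(\<Sum>i\<le>Suc (Suc q). (if i \<le> q then real (Suc q) * b i else 0) * x ^ i) = real (Suc q) * hermite q x"
      unfolding b by (simp add: sum_distrib_left mult_ac)
    ultimately show ?thesis
      by (simp add: c_def left_diff_distrib sum_subtractf del: sum.atMost_Suc)
  qed
  then show ?case by blast
qed

lemma integrable_hermite: "integrable lborel (\<lambda>x. hermite n x * std_normal_density x)"
proof -
  obtain c where c: "\<And>x. hermite n x = (\<Sum>i\<le>n. c i * x ^ i)" using hermite_eq_poly by blast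
  have "integrable lborel (\<lambda>x. \<Sum>i\<le>n. c i * (std_normal_density x * x ^ i))"
    by (intro Bochner_Integration.integrable_sum integrable_mult_right integrable_std_normal_moment)
  then show ?thesis by (simp add: c sum_distrib_left mult_ac)
qed

lemma tendsto_hermite_mult_std_normal_density:
  "((\<lambda>x. hermite n x * std_normal_density x) \<longlongrightarrow> 0) at_top"
proof -
  obtain c where c: "\<And>x. hermite n x = (\<Sum>i\<le>n. c i * x ^ i)" using hermite_eq_poly by blast
  have 1: "((\<lambda>x::real. x ^ i * std_normal_density x) \<longlongrightarrow> 0) at_top" for i
    unfolding std_normal_density_def by real_asymp
  have "((\<lambda>x. \<Sum>i\<le>n. c i * (x ^ i * std_normal_density x)) \<longlongrightarrow> (\<Sum>i\<le>n. c i * 0)) at_top"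
    by (intro tendsto_intros 1)
  then show ?thesis by (simp add: c sum_distrib_left mult_ac)
qed

text \<open>The integrand H_{n+1} \<phi> has antiderivative -H_n \<phi>, which vanishes at infinity,
  so only the boundary term at u survives.\<close>

lemma hermite_coeff_indicator:
  "hermite_coeff (Suc n) (indicator {u..}) = hermite n u * std_normal_density u / fact (Suc n)"
proof -
  let ?f = "\<lambda>x. hermite (Suc n) x * std_normal_density x"
  let ?F = "\<lambda>x. - (hermite n x * std_normal_density x)"
  have "(LBINT x=ereal u..\<infinity>. ?f x) = 0 - ?F u"
  proof (rule interval_integral_FTC_integrable[where F = ?F])
    show "isCont ?f x" for x
      by (intro continuous_intros isCont_hermite) (simp add: std_normal_density_def)
    show "set_integrable lborel (einterval (ereal u) \<infinity>) ?f"
      unfolding set_integrable_def by (intro integrable_mult_indicator integrable_hermite) auto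
    have "isCont ?F u"
      using DERIV_hermite_mult_std_normal_density DERIV_isCont by blast
    then have "(?F \<longlongrightarrow> ?F u) (at_right u)"
      unfolding isCont_def by (rule filterlim_at_split[THEN iffD1, THEN conjunct2])
    then show "((?F \<circ> real_of_ereal) \<longlongrightarrow> ?F u) (at_right (ereal u))"
      by (simp add: ereal_tendsto_simps)
    have "(?F \<longlongrightarrow> - 0) at_top"
      by (intro tendsto_minus tendsto_hermite_mult_std_normal_density)
    then show "((?F \<circ> real_of_ereal) \<longlongrightarrow> 0) (at_left \<infinity>)"
      by (simp add: ereal_tendsto_simps)
    show "(?F has_vector_derivative ?f x) (at x)" for x
      using DERIV_hermite_mult_std_normal_density has_real_derivative_iff_has_vector_derivative by blast
  qed simp
  \<comment> \<open>The interval integral runs over the open half-line; the endpoint u is a null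
    set.\<close>
  also have "(LBINT x=ereal u..\<infinity>. ?f x) = (\<integral>x. indicator {u..} x * ?f x \<partial>lborel)"
  proof -
    have "(LBINT x=ereal u..\<infinity>. ?f x) = (\<integral>x. indicator {u<..} x * ?f x \<partial>lborel)"
      by (simp add: interval_lebesgue_integral_def set_lebesgue_integral_def)
    also have "\<dots> = (\<integral>x. indicator {u..} x * ?f x \<partial>lborel)"
      using AE_lborel_singleton[of u]
      by (intro integral_cong_AE) (auto elim!: eventually_mono split: split_indicator)
    finally show ?thesis .
  qed
  finally show ?thesis
    by (simp add: hermite_coeff_def mult_ac)
qed

text \<open>The Christoffel--Darboux identity on the diagonal. Being quadratic in two consecutive
  Hermite values, it shows that the partial sums play the role of an energy of the recurrence.\<close>

lemma hermite_sum_squares: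
  "(\<Sum>k\<le>n. (hermite k x)\<^sup>2 / fact k) =
    ((hermite (Suc n) x)\<^sup>2 + real (Suc n) * (hermite n x)\<^sup>2 - x * hermite n x * hermite (Suc n) x) / fact n"
proof (induction n)
  case 0
  then show ?case by (simp add: power2_eq_square)
next
  case (Suc n)
  \<comment> \<open>Read a = H_n, b = H_{n+1}, m = n + 1, f = n!; by the recurrence, x b - m a is
    H_{n+2}.\<close>
  have *: "(b\<^sup>2 + m * a\<^sup>2 - x * a * b) / f + b\<^sup>2 / (m * f) =
      ((x * b - m * a)\<^sup>2 + (m + 1) * b\<^sup>2 - x * b * (x * b - m * a)) / (m * f)"
    if "m > 0" "f > 0" for a b m f :: real
    using that by (simp add: field_simps power2_eq_square)
  show ?case
    using *[of "real (Suc n)" "fact n" "hermite (Suc n) x" "hermite n x"] by (simp add: Suc add_ac)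
qed

section \<open>Growth of two consecutive normalized Hermite squares\<close>

lemma bounded_if_two_step_increments_summable:
  fixes L b :: "nat \<Rightarrow> real"
  assumes b: "summable b" "\<And>n. 0 \<le> b n"
    and ev: "\<forall>\<^sub>F n in sequentially. \<bar>L (n + 2) - L n\<bar> \<le> b n"
  shows "\<exists>A. \<forall>\<^sub>F n in sequentially. \<bar>L n\<bar> \<le> A"
proof -
  obtain N where N: "\<And>n. n \<ge> N \<Longrightarrow> \<bar>L (n + 2) - L n\<bar> \<le> b n"
    using ev by (auto simp: eventually_sequentially)
  \<comment> \<open>Telescoping by steps of two treats even and odd indices separately, so both
    starting values enter.\<close>
  define A where "A = \<bar>L N\<bar> + \<bar>L (N + 1)\<bar>"
  have "\<bar>L n\<bar> \<le> A + (\<Sum>i<n. b i)" if "n \<ge> N" for n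
    using that
  proof (induction n rule: less_induct)
    case (less n)
    have s: "(\<Sum>i<n. b i) \<ge> 0" using b by (simp add: sum_nonneg)
    show ?case
    proof (cases "n \<ge> N + 2")
      case True
      define m where "m = n - 2"
      have m: "n = m + 2" "m \<ge> N" using True by (auto simp: m_def)
      have "\<bar>L n\<bar> \<le> \<bar>L m\<bar> + b m" using N[of m] m(2) unfolding m(1) by linarith
      also have "\<bar>L m\<bar> \<le> A + (\<Sum>i<m. b i)" using less(1)[of m] m by simp
      also have "A + (\<Sum>i<m. b i) + b m = A + (\<Sum>i<Suc m. b i)" by simp
      also have "\<dots> \<le> A + (\<Sum>i<n. b i)" using m b by simp
      finally show ?thesis by simp
    next
      case False
      then have "n = N \<or> n = N + 1" using less(2) by auto
      then show ?thesis using s by (auto simp: A_def)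
    qed
  qed
  moreover have "(\<Sum>i<n. b i) \<le> suminf b" for n
    using b by (intro sum_le_suminf) auto
  ultimately have "\<bar>L n\<bar> \<le> A + suminf b" if "n \<ge> N" for n
    using that by (meson add_left_mono order_trans)
  then show ?thesis by (auto simp: eventually_sequentially)
qed

text \<open>A single term need not be comparable with its predecessor, but in two steps the partial sum
  grows by a factor \<open>1 + 1 / n + O(n powr (-3/2))\<close>, hence like the square root of \<open>n\<close>.\<close>

lemma sum_two_terms_asymp_inverse_sqrt:
  fixes e :: "nat \<Rightarrow> real" and K :: real
  defines "S \<equiv> \<lambda>n. \<Sum>k\<le>n. e k"
  assumes e: "\<And>n. e n \<ge> 0" "e 0 > 0" and K: "K > 0"
    and energy: "\<And>n. \<bar>S n - real (Suc n) * (e n + e (Suc n))\<bar> \<le> K * sqrt (real (Suc n)) * (e n + e (Suc n))"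
  shows "\<exists>c C. c > 0 \<and> C > 0 \<and> (\<forall>\<^sub>F n in sequentially.
    c / sqrt (real n) \<le> e n + e (Suc n) \<and> e n + e (Suc n) \<le> C / sqrt (real n))"
proof -
  have S0: "S n > 0" for n
  proof -
    have "e 0 \<le> S n" unfolding S_def using e by (intro member_le_sum) auto
    then show ?thesis using e by simp
  qed
  have S_mono: "S n \<le> S (Suc n)" for n using e by (simp add: S_def)
  have low: "S n \<le> (e n + e (Suc n)) * (real (Suc n) + K * sqrt (real (Suc n)))"
    and up: "(e n + e (Suc n)) * (real (Suc n) - K * sqrt (real (Suc n))) \<le> S n" for n
    using energy[of n] by (auto simp: abs_le_iff algebra_simps)
  \<comment> \<open>Monotonicity of \<open>S\<close> turns the energy bounds at index n + 1 into
    S(n+2) >= (1 + g n) S(n) and (1 - h n) S(n+2) <= S(n). The sequence \<open>l\<close> is the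
    two-step increment of ln(n + 1) / 2, so \<open>L\<close> measures the deviation of ln S from
    square-root growth.\<close>
  define g where "g n = 1 / (real (n + 2) + K * sqrt (real (n + 2)))" for n :: nat
  define h where "h n = 1 / (real (n + 2) - K * sqrt (real (n + 2)))" for n :: nat
  define l where "l n = 1 / 2 * (ln (real (n + 3)) - ln (real (n + 1)))" for n :: nat
  define L where "L n = ln (S n) - 1 / 2 * ln (real (n + 1))" for n
  have g: "g n > 0" for n using K by (auto simp: g_def intro!: divide_pos_pos add_pos_nonneg)
  have step_low: "ln (1 + g n) \<le> ln (S (n + 2)) - ln (S n)" for n
  proof -
    have "S n \<le> S (Suc n)" by (rule S_mono)
    also note low[of "Suc n"]
    finally have "S n \<le> (e (Suc n) + e (Suc (Suc n))) / g n" by (simp add: g_def)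
    then have "S n * g n \<le> e (Suc n) + e (Suc (Suc n))" using g by (simp add: pos_le_divide_eq)
    then have "S n * (1 + g n) \<le> S (n + 2)" by (simp add: S_def algebra_simps)
    then have "ln (S n * (1 + g n)) \<le> ln (S (n + 2))"
      using S0[of n] g[of n] by (intro ln_mono) (auto intro!: mult_pos_pos)
    then show ?thesis using S0[of n] g[of n] by (simp add: ln_mult)
  qed
  have step_up: "ln (S (n + 2)) - ln (S n) \<le> - ln (1 - h n)" if h: "h n > 0" "h n < 1" for n
  proof -
    have "real (n + 2) - K * sqrt (real (n + 2)) > 0" using h by (simp add: h_def)
    moreover note up[of "Suc n"]
    ultimately have "e (Suc n) + e (Suc (Suc n)) \<le> S (Suc n) * h n"
      by (simp add: h_def field_simps)
    also have "\<dots> \<le> S (n + 2) * h n"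
      using S_mono[of "Suc n"] h by (intro mult_right_mono) auto
    finally have "S (n + 2) * (1 - h n) \<le> S n" by (simp add: S_def algebra_simps)
    then have "ln (S (n + 2) * (1 - h n)) \<le> ln (S n)"
      using S0[of "n + 2"] h by (intro ln_mono) (auto intro!: mult_pos_pos)
    then show ?thesis using S0[of "n + 2"] h by (simp add: ln_mult)
  qed
  have ev_h: "\<forall>\<^sub>F n in sequentially. h n > 0" "\<forall>\<^sub>F n in sequentially. h n < 1"
    unfolding h_def using K by real_asymp+
  \<comment> \<open>All three of ln(1 + g), -ln(1 - h) and l start with 1/n. After cancellation the
    order n^(-3/2) comes from the square-root error in the energy bound.\<close>
  have O1: "(\<lambda>n. ln (1 + g n) - l n) \<in> O(\<lambda>n. real n powr (- 3 / 2))"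
    unfolding g_def l_def using K by real_asymp
  have O2: "(\<lambda>n. - ln (1 - h n) - l n) \<in> O(\<lambda>n. real n powr (- 3 / 2))"
    unfolding h_def l_def using K by real_asymp
  obtain A1 where A1: "\<forall>\<^sub>F n in sequentially. norm (ln (1 + g n) - l n) \<le> A1 * norm (real n powr (- 3 / 2))"
    using O1 by (elim landau_o.bigE)
  obtain A2 where A2: "\<forall>\<^sub>F n in sequentially. norm (- ln (1 - h n) - l n) \<le> A2 * norm (real n powr (- 3 / 2))"
    using O2 by (elim landau_o.bigE)
  define b where "b n = (\<bar>A1\<bar> + \<bar>A2\<bar>) * real n powr (- 3 / 2)" for n :: nat
  have "\<forall>\<^sub>F n in sequentially. \<bar>L (n + 2) - L n\<bar> \<le> b n"
    using ev_h A1 A2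
  proof eventually_elim
    case (elim n)
    have "L (n + 2) - L n = ln (S (n + 2)) - ln (S n) - l n"
      by (simp add: L_def l_def algebra_simps)
    moreover have "A1 * real n powr (- 3 / 2) \<le> b n" "A2 * real n powr (- 3 / 2) \<le> b n"
      unfolding b_def by (intro mult_right_mono; simp)+
    ultimately show ?case
      using step_low[of n] step_up[of n] elim by (simp add: abs_le_iff)
  qed
  moreover have "summable b"
    unfolding b_def by (intro summable_mult) (simp add: summable_real_powr_iff)
  ultimately obtain A where A: "\<forall>\<^sub>F n in sequentially. \<bar>L n\<bar> \<le> A"
    using bounded_if_two_step_increments_summable[of b L] by (auto simp: b_def)
  have SL: "S n = exp (L n) * sqrt (real (n + 1))" for n
    using S0[of n] by (simp add: L_def exp_diff ln_sqrt[symmetric])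
  \<comment> \<open>The quotients in \<open>ev1\<close> and \<open>ev2\<close> are asymptotic to 1 /
    sqrt n, so the factors 1 / (2 (1 + K)) < 1 and 2 > 1 leave room for the lower-order
    terms.\<close>
  define c where "c = exp (- A) / (2 * (1 + K))"
  define C where "C = 2 * exp A"
  have ev1: "\<forall>\<^sub>F n in sequentially. sqrt (real (n + 1)) / (real (Suc n) + K * sqrt (real (Suc n))) \<ge>
      1 / (2 * (1 + K)) / sqrt (real n)"
    using K by real_asymp
  have ev2: "\<forall>\<^sub>F n in sequentially. sqrt (real (n + 1)) / (real (Suc n) - K * sqrt (real (Suc n))) \<le>
      2 / sqrt (real n)"
    using K by real_asymp
  have ev3: "\<forall>\<^sub>F n in sequentially. real (Suc n) - K * sqrt (real (Suc n)) > 0"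
    using K by real_asymp
  have "\<forall>\<^sub>F n in sequentially. c / sqrt (real n) \<le> e n + e (Suc n) \<and> e n + e (Suc n) \<le> C / sqrt (real n)"
    using A ev1 ev2 ev3
  proof eventually_elim
    case (elim n)
    let ?r = "sqrt (real (n + 1))"
    let ?m = "real (Suc n) - K * sqrt (real (Suc n))" and ?p = "real (Suc n) + K * sqrt (real (Suc n))"
    have exps: "exp (- A) \<le> exp (L n)" "exp (L n) \<le> exp A" using elim by auto
    have p: "?p > 0" using K by (intro add_pos_nonneg) auto
    have "c / sqrt (real n) = exp (- A) * (1 / (2 * (1 + K)) / sqrt (real n))"
      by (simp add: c_def)
    also have "\<dots> \<le> exp (L n) * (?r / ?p)"
      using K elim exps by (intro mult_mono) auto
    also have "\<dots> = S n / ?p" by (simp add: SL)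
    also have "\<dots> \<le> e n + e (Suc n)" using low[of n] p by (simp add: field_simps)
    finally have 1: "c / sqrt (real n) \<le> e n + e (Suc n)" .
    have "e n + e (Suc n) \<le> S n / ?m" using up[of n] elim by (simp add: field_simps)
    also have "\<dots> = exp (L n) * (?r / ?m)" by (simp add: SL)
    also have "\<dots> \<le> exp A * (2 / sqrt (real n))"
      using elim exps by (intro mult_mono) auto
    finally have "e n + e (Suc n) \<le> C / sqrt (real n)" by (simp add: C_def mult.commute)
    with 1 show ?case ..
  qed
  moreover have "c > 0" "C > 0" using K by (auto simp: c_def C_def)
  ultimately show ?thesis by blast
qed

text \<open>The energy defect is exactly the cross term -x H_n H_{n+1} / n!. The
  arithmetic-geometric mean inequality weighted by sqrt(n + 1) bounds it by a multiple of |x| sqrt(n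
  + 1) times the two-term sum. Adding 1 to |x| keeps \<open>K\<close> positive at x = 0.\<close>

lemma hermite_two_terms_asymp:
  "\<exists>c C. c > 0 \<and> C > 0 \<and> (\<forall>\<^sub>F n in sequentially.
    c / sqrt (real n) \<le> (hermite n x)\<^sup>2 / fact n + (hermite (Suc n) x)\<^sup>2 / fact (Suc n) \<and>
    (hermite n x)\<^sup>2 / fact n + (hermite (Suc n) x)\<^sup>2 / fact (Suc n) \<le> C / sqrt (real n))"
proof (rule sum_two_terms_asymp_inverse_sqrt[where K = "\<bar>x\<bar> + 1"])
  fix n :: nat
  define a where "a = hermite n x"
  define b where "b = hermite (Suc n) x"
  define s where "s = sqrt (real (Suc n))"
  have s: "s > 0" "s\<^sup>2 = real (Suc n)" by (simp_all add: s_def)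
  have E: "a\<^sup>2 / fact n + b\<^sup>2 / fact (Suc n) = (s\<^sup>2 * a\<^sup>2 + b\<^sup>2) / (s\<^sup>2 * fact n)"
    unfolding s by (simp add: field_simps del: of_nat_Suc)
  have "(\<Sum>k\<le>n. (hermite k x)\<^sup>2 / fact k) - real (Suc n) * (a\<^sup>2 / fact n + b\<^sup>2 / fact (Suc n)) =
     (b\<^sup>2 + s\<^sup>2 * a\<^sup>2 - x * a * b) / fact n - (s\<^sup>2 * a\<^sup>2 + b\<^sup>2) / fact n"
    unfolding hermite_sum_squares E s(2)[symmetric] using s by (simp add: a_def b_def)
  also have "\<dots> = - (x * (a * b)) / fact n"
    by (simp add: diff_divide_distrib add_divide_distrib)
  finally have "\<bar>(\<Sum>k\<le>n. (hermite k x)\<^sup>2 / fact k) - real (Suc n) * (a\<^sup>2 / fact n + b\<^sup>2 / fact (Suc n))\<bar>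
    = \<bar>x\<bar> * \<bar>a * b\<bar> / fact n" by (simp add: abs_mult)
  also have "\<dots> \<le> (\<bar>x\<bar> + 1) * ((s\<^sup>2 * a\<^sup>2 + b\<^sup>2) / s) / fact n"
  proof (intro divide_right_mono mult_mono)
    have "2 * s * \<bar>a * b\<bar> \<le> s\<^sup>2 * a\<^sup>2 + b\<^sup>2"
      using sum_squares_bound[of "s * \<bar>a\<bar>" "\<bar>b\<bar>"] by (simp add: power_mult_distrib abs_mult mult_ac)
    moreover have "s * \<bar>a * b\<bar> \<ge> 0" using s by simp
    ultimately have "s * \<bar>a * b\<bar> \<le> s\<^sup>2 * a\<^sup>2 + b\<^sup>2" by linarith
    then show "\<bar>a * b\<bar> \<le> (s\<^sup>2 * a\<^sup>2 + b\<^sup>2) / s" using s by (simp add: field_simps)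
  qed auto
  also have "\<dots> = (\<bar>x\<bar> + 1) * s * (a\<^sup>2 / fact n + b\<^sup>2 / fact (Suc n))"
    unfolding E using s(1) by (simp add: power2_eq_square)
  finally show "\<bar>(\<Sum>k\<le>n. (hermite k x)\<^sup>2 / fact k) - real (Suc n) *
      ((hermite n x)\<^sup>2 / fact n + (hermite (Suc n) x)\<^sup>2 / fact (Suc n))\<bar>
     \<le> (\<bar>x\<bar> + 1) * sqrt (real (Suc n)) * ((hermite n x)\<^sup>2 / fact n + (hermite (Suc n) x)\<^sup>2 / fact (Suc n))"
    by (simp only: a_def b_def s_def)
qed auto

subsection \<open>The chaos series of the excursion volume\<close>

lemma sin_ge_half:
  fixes t :: real
  assumes "0 \<le> t" "t \<le> pi / 2"
  shows "t / 2 \<le> sin t"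
\<comment> \<open>Up to pi/3 the derivative cos t - 1/2 is nonnegative; beyond it, sin t >=
  sin(pi/3) >= pi/4 >= t/2.\<close>
proof (cases "t \<le> pi / 3")
  case True
  have "sin 0 - 0 / 2 \<le> sin t - t / 2"
  proof (rule DERIV_nonneg_imp_nondecreasing[OF assms(1)])
    fix s assume s: "0 \<le> s" "s \<le> t"
    then have "cos (pi / 3) \<le> cos s" using True pi_gt_zero by (intro cos_monotone_0_pi_le) auto
    then have "0 \<le> cos s - 1 / 2" by (simp add: cos_60)
    moreover have "((\<lambda>s. sin s - s / 2) has_real_derivative cos s - 1 / 2) (at s)"
      by (auto intro!: derivative_eq_intros)
    ultimately show "\<exists>y. ((\<lambda>s. sin s - s / 2) has_real_derivative y) (at s) \<and> 0 \<le> y" by blast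
  qed
  then show ?thesis by simp
next
  case False
  have "17 / 10 \<le> sqrt (3::real)" by (rule real_le_rsqrt) (simp add: power2_eq_square)
  then have "pi / 4 \<le> sin (pi / 3)" using pi_less_4 pi_approx by (simp add: sin_60)
  also have "\<dots> \<le> sin t" using False assms pi_gt_zero by (intro sin_monotone_2pi_le) auto
  finally show ?thesis using assms by simp
qed

text \<open>The kernel hypothesis speaks of angles, the cap estimates of Euclidean distance. They
  are linked by the chord formula: the distance is 2 sin(\<theta>/2) for the angle \<theta>.\<close>

lemma sphere_dist_arccos:
  fixes x y :: "'a::euclidean_space"
  assumes "x \<in> sphere 0 1" "y \<in> sphere 0 1"
  shows "dist x y \<le> arccos (x \<bullet> y)" "arccos (x \<bullet> y) \<le> 2 * dist x y"
    "0 \<le> arccos (x \<bullet> y)" "arccos (x \<bullet> y) \<le> pi" "cos (arccos (x \<bullet> y)) = x \<bullet> y" "\<bar>x \<bullet> y\<bar> \<le> 1"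
proof -
  define \<theta> where "\<theta> = arccos (x \<bullet> y)"
  show xy: "\<bar>x \<bullet> y\<bar> \<le> 1" using Cauchy_Schwarz_ineq2[of x y] assms by simp
  then have b: "-1 \<le> x \<bullet> y" "x \<bullet> y \<le> 1" by auto
  show c: "cos (arccos (x \<bullet> y)) = x \<bullet> y" "0 \<le> arccos (x \<bullet> y)" "arccos (x \<bullet> y) \<le> pi"
    using b by (auto simp: arccos_bounded)
  have \<theta>: "0 \<le> \<theta> / 2" "\<theta> / 2 \<le> pi / 2" using c by (auto simp: \<theta>_def)
  have "(dist x y)\<^sup>2 = 2 - 2 * (x \<bullet> y)"
  proof -
    have "x \<bullet> x = 1" "y \<bullet> y = 1" using assms by (simp_all flip: power2_norm_eq_inner)
    then show ?thesis
      by (simp add: dist_norm power2_norm_eq_inner inner_diff_left inner_diff_right inner_commute[of y x])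
  qed
  also have "x \<bullet> y = cos (2 * (\<theta> / 2))" using c by (simp add: \<theta>_def)
  also have "2 - 2 * cos (2 * (\<theta> / 2)) = (2 * sin (\<theta> / 2))\<^sup>2"
    by (subst cos_double_sin) (simp add: power2_eq_square)
  finally have d: "dist x y = 2 * sin (\<theta> / 2)"
  proof (rule power2_eq_imp_eq)
    show "0 \<le> 2 * sin (\<theta> / 2)" using \<theta> sin_ge_zero[of "\<theta> / 2"] by simp
  qed simp
  show "dist x y \<le> arccos (x \<bullet> y)" using sin_x_le_x[OF \<theta>(1)] by (simp add: d \<theta>_def)
  show "arccos (x \<bullet> y) \<le> 2 * dist x y" using sin_ge_half[OF \<theta>] by (simp add: d \<theta>_def)
qed

text \<open>Both the halved radius and the factor 2^\<alpha> come from the angle being at most twice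
  the chord.\<close>

lemma zonal_kernel_ge:
  fixes x y :: "'a::euclidean_space"
  assumes xy: "x \<in> sphere 0 1" "y \<in> sphere 0 1" "dist x y \<le> \<epsilon> / 2" and pos: "C\<^sub>2 > 0" "\<alpha> > 0"
    and near: "\<And>\<theta>. \<bar>\<theta>\<bar> \<le> \<epsilon> \<Longrightarrow> 1 - \<kappa> (cos \<theta>) \<le> C\<^sub>2 * \<bar>\<theta>\<bar> powr \<alpha>"
  shows "1 - C\<^sub>2 * 2 powr \<alpha> * dist x y powr \<alpha> \<le> \<kappa> (x \<bullet> y)"
proof -
  let ?\<theta> = "arccos (x \<bullet> y)"
  note * = sphere_dist_arccos[OF xy(1,2)]
  have "1 - \<kappa> (x \<bullet> y) \<le> C\<^sub>2 * ?\<theta> powr \<alpha>" using near[of ?\<theta>] * xy(3) by simp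
  also have "\<dots> \<le> C\<^sub>2 * (2 * dist x y) powr \<alpha>" using * pos by (intro mult_left_mono powr_mono2) auto
  finally show ?thesis by (simp add: powr_mult)
qed

text \<open>Near the diagonal this is 1 - t <= exp(-t). Elsewhere compactness bounds |\<kappa>| by a
  constant below 1, and since distances on the sphere are at most 2, such a constant is itself
  dominated by the exponential for small \<open>c\<close>.\<close>

lemma zonal_kernel_abs_le_exp:
  assumes cont: "continuous_on {-1..1} \<kappa>"
    and pos: "C\<^sub>1 > 0" "C\<^sub>2 > 0" "\<alpha> > 0" "\<epsilon> > 0"
    and lt1: "\<And>t. t \<in> {-1..1} \<Longrightarrow> t \<noteq> 1 \<Longrightarrow> \<bar>\<kappa> t\<bar> < 1"
    and near: "\<And>\<theta>. \<bar>\<theta>\<bar> \<le> \<epsilon> \<Longrightarrow>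
                 C\<^sub>1 * \<bar>\<theta>\<bar> powr \<alpha> \<le> 1 - \<kappa> (cos \<theta>) \<and> 1 - \<kappa> (cos \<theta>) \<le> C\<^sub>2 * \<bar>\<theta>\<bar> powr \<alpha>"
  shows "\<exists>c>0. \<forall>x\<in>sphere (0::'a::euclidean_space) 1. \<forall>y\<in>sphere 0 1.
    \<bar>\<kappa> (x \<bullet> y)\<bar> \<le> exp (- (c * dist x y powr \<alpha>))"
proof -
  define e where "e = min (min \<epsilon> 1) ((1 / C\<^sub>2) powr (1 / \<alpha>))"
  have e: "0 < e" "e \<le> \<epsilon>" "e \<le> 1" using pos by (auto simp: e_def)
  have Ce: "C\<^sub>2 * e powr \<alpha> \<le> 1"
  proof -
    have "e powr \<alpha> \<le> ((1 / C\<^sub>2) powr (1 / \<alpha>)) powr \<alpha>" using pos e by (intro powr_mono2) (auto simp: e_def)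
    also have "\<dots> = 1 / C\<^sub>2" using pos by (simp add: powr_powr)
    finally show ?thesis using pos by (simp add: field_simps)
  qed
  have e_pi: "e < pi" using e pi_gt3 by simp
  have cos_e: "cos e < 1" using cos_monotone_0_pi[of 0 e] e e_pi by simp
  have "\<exists>s\<in>{-1..cos e}. \<forall>t\<in>{-1..cos e}. \<bar>\<kappa> t\<bar> \<le> \<bar>\<kappa> s\<bar>"
    using cos_e by (intro continuous_attains_sup continuous_intros continuous_on_subset[OF cont]) auto
  then obtain s where s: "s \<in> {-1..cos e}" "\<And>t. t \<in> {-1..cos e} \<Longrightarrow> \<bar>\<kappa> t\<bar> \<le> \<bar>\<kappa> s\<bar>" by blast
  \<comment> \<open>The maximum with 1/2 keeps the logarithm meaningful even if \<kappa> vanishes on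
    the whole far range.\<close>
  define \<rho> where "\<rho> = max \<bar>\<kappa> s\<bar> (1 / 2)"
  have \<rho>: "0 < \<rho>" "\<rho> < 1" using lt1[of s] s cos_e by (auto simp: \<rho>_def)
  define c where "c = min C\<^sub>1 (- ln \<rho> / 2 powr \<alpha>)"
  have c: "c > 0" using pos \<rho> by (auto simp: c_def divide_neg_pos)
  have "\<bar>\<kappa> (x \<bullet> y)\<bar> \<le> exp (- (c * dist x y powr \<alpha>))" if xy: "x \<in> sphere 0 1" "y \<in> sphere 0 1" for x y :: 'a
  proof -
    let ?\<theta> = "arccos (x \<bullet> y)"
    note * = sphere_dist_arccos[OF xy]
    show ?thesis
    proof (cases "?\<theta> \<le> e")
      case True
      then have 1: "C\<^sub>1 * ?\<theta> powr \<alpha> \<le> 1 - \<kappa> (x \<bullet> y)" "1 - \<kappa> (x \<bullet> y) \<le> C\<^sub>2 * ?\<theta> powr \<alpha>"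
        using near[of ?\<theta>] * e by auto
      have "C\<^sub>2 * ?\<theta> powr \<alpha> \<le> C\<^sub>2 * e powr \<alpha>" using True * pos by (intro mult_left_mono powr_mono2) auto
      then have "0 \<le> \<kappa> (x \<bullet> y)" using 1 Ce by linarith
      then have "\<bar>\<kappa> (x \<bullet> y)\<bar> \<le> 1 + - (C\<^sub>1 * ?\<theta> powr \<alpha>)" using 1 by simp
      also have "\<dots> \<le> exp (- (C\<^sub>1 * ?\<theta> powr \<alpha>))" by (rule exp_ge_add_one_self)
      also have "\<dots> \<le> exp (- (c * dist x y powr \<alpha>))"
      proof -
        have "c * dist x y powr \<alpha> \<le> C\<^sub>1 * ?\<theta> powr \<alpha>"
          using * pos c by (intro mult_mono powr_mono2) (auto simp: c_def)
        then show ?thesis by simp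
      qed
      finally show ?thesis .
    next
      case False
      then have "cos ?\<theta> \<le> cos e" using * e by (intro cos_monotone_0_pi_le) auto
      then have "x \<bullet> y \<in> {-1..cos e}" using * by (auto simp: abs_le_iff)
      then have "\<bar>\<kappa> (x \<bullet> y)\<bar> \<le> \<rho>" using s(2) by (simp add: \<rho>_def le_max_iff_disj)
      also have "\<rho> = exp (- (- ln \<rho>))" using \<rho> by simp
      also have "\<dots> \<le> exp (- (c * dist x y powr \<alpha>))"
      proof -
        have "dist x y \<le> 2" using dist_triangle2[of x y 0] xy by (simp add: dist_commute)
        then have "c * dist x y powr \<alpha> \<le> (- ln \<rho> / 2 powr \<alpha>) * 2 powr \<alpha>"
          using pos c by (intro mult_mono powr_mono2) (auto simp: c_def)
        then show ?thesis by simp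
      qed
      finally show ?thesis .
    qed
  qed
  with c show ?thesis by blast
qed

text \<open>Continuity is given on [-1, 1] only, so \<kappa> is replaced by its extension by zero;
  by Cauchy-Schwarz the two agree on inner products of unit vectors.\<close>

lemma borel_measurable_zonal_kernel:
  fixes \<kappa> :: "real \<Rightarrow> real"
  assumes "continuous_on {-1..1} \<kappa>"
  shows "(\<lambda>(x, y). \<kappa> (x \<bullet> y)) \<in>
    borel_measurable (sphere_measure \<Otimes>\<^sub>M (sphere_measure :: 'a::euclidean_space measure))"
proof -
  have id [measurable]: "(\<lambda>x. x) \<in> (sphere_measure :: 'a measure) \<rightarrow>\<^sub>M borel"
    by (subst measurable_cong_sets[OF sets_sphere_measure refl]) (rule measurable_restrict_space1, simp)
  have [measurable]: "(\<lambda>t. indicator {-1..1} t *\<^sub>R \<kappa> t) \<in> borel_measurable borel"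
    using assms by (intro borel_measurable_continuous_on_indicator) auto
  have "(\<lambda>p. indicator {-1..1} (fst p \<bullet> snd p) *\<^sub>R \<kappa> (fst p \<bullet> snd p)) \<in>
      borel_measurable (sphere_measure \<Otimes>\<^sub>M (sphere_measure :: 'a measure))"
    by (rule measurable_compose[of "\<lambda>p. fst p \<bullet> snd p" _ borel]) measurable
  also have "?this \<longleftrightarrow> ?thesis"
  proof (rule measurable_cong)
    fix p :: "'a \<times> 'a" assume "p \<in> space (sphere_measure \<Otimes>\<^sub>M sphere_measure)"
    then have "fst p \<in> sphere 0 1" "snd p \<in> sphere 0 1" by (auto simp: space_pair_measure)
    from sphere_dist_arccos(6)[OF this]
    show "indicator {-1..1} (fst p \<bullet> snd p) *\<^sub>R \<kappa> (fst p \<bullet> snd p) = (case p of (x, y) \<Rightarrow> \<kappa> (x \<bullet> y))"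
      by (auto simp: case_prod_unfold abs_le_iff indicator_def)
  qed
  finally show ?thesis .
qed

text \<open>For divergence the lower bound is available only for sums of two consecutive terms:
  single values \<open>h n\<close> may vanish, as Hermite polynomials of odd degree do at the origin.\<close>

lemma summable_iff_two_terms_asymp:
  fixes h I :: "nat \<Rightarrow> real" and p :: nat and D :: real
  assumes h: "\<And>n. h n \<ge> 0" "c > 0" "C > 0" "\<forall>\<^sub>F n in sequentially.
      c / sqrt (real n) \<le> h n + h (Suc n) \<and> h n + h (Suc n) \<le> C / sqrt (real n)"
    and I: "a > 0" "b > 0" "\<forall>\<^sub>F q in sequentially. a * real q powr - D \<le> I q \<and> I q \<le> b * real q powr - D"
  shows "summable (\<lambda>n. real (Suc n) ^ p * (h n / real (Suc n)) * I (Suc n)) \<longleftrightarrow> real p < D + 1 / 2"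
proof -
  define f where "f n = real (Suc n) ^ p * (h n / real (Suc n)) * I (Suc n)" for n
  \<comment> \<open>This collects every factor except \<open>h\<close>, with q = n + 1: the power p,
    the division by q, and the order q^(-D) of the kernel integral.\<close>
  define w where "w n = real (Suc n) powr (real p - 1 - D)" for n
  have w: "real (Suc n) ^ p * (t / real (Suc n)) * real (Suc n) powr - D = w n * t" for n t
    by (simp add: w_def powr_diff powr_minus_divide flip: powr_realpow)
  have I': "\<forall>\<^sub>F n in sequentially. a * real (Suc n) powr - D \<le> I (Suc n) \<and> I (Suc n) \<le> b * real (Suc n) powr - D"
    using I(3) eventually_sequentially_Suc[of "\<lambda>q. a * real q powr - D \<le> I q \<and> I q \<le> b * real q powr - D"] by simp
  have f_bounds: "\<forall>\<^sub>F n in sequentially. a * (w n * h n) \<le> f n \<and> f n \<le> b * (w n * h n)"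
    using I'
  proof eventually_elim
    case (elim n)
    let ?u = "real (Suc n) ^ p * (h n / real (Suc n))"
    have u: "?u \<ge> 0" using h(1)[of n] by simp
    have "?u * (a * real (Suc n) powr - D) \<le> ?u * I (Suc n)"
      "?u * I (Suc n) \<le> ?u * (b * real (Suc n) powr - D)"
      by (intro mult_left_mono u; use elim in simp)+
    then show ?case by (simp add: f_def mult.left_commute flip: w)
  qed
  have w0: "w n > 0" for n by (simp add: w_def)
  show ?thesis
  proof
    assume p: "real p < D + 1 / 2"
    have "\<forall>\<^sub>F n in sequentially. norm (f n) \<le> b * (w n * (C / sqrt (real n)))"
      using f_bounds h(4)
    proof eventually_elim
      case (elim n)
      have "0 \<le> a * (w n * h n)" using I(1) h(1)[of n] w0[of n] by simp
      moreover have "b * (w n * h n) \<le> b * (w n * (C / sqrt (real n)))"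
        using elim I(2) w0[of n] h(1)[of "Suc n"] by (intro mult_left_mono) auto
      ultimately show ?case using elim by simp
    qed
    moreover have "summable (\<lambda>n. b * (w n * (C / sqrt (real n))))"
    proof (rule summable_comparison_test_bigo)
      show "(\<lambda>n. b * (w n * (C / sqrt (real n)))) \<in> O(\<lambda>n. real n powr (real p - 3 / 2 - D))"
        unfolding w_def using I(2) h(3) by real_asymp
      show "summable (\<lambda>n. norm (real n powr (real p - 3 / 2 - D)))"
        using p by (simp add: summable_real_powr_iff)
    qed
    ultimately show "summable (\<lambda>n. real (Suc n) ^ p * (h n / real (Suc n)) * I (Suc n))"
      unfolding f_def[symmetric] by (rule summable_comparison_test_ev)
  next
    assume "summable (\<lambda>n. real (Suc n) ^ p * (h n / real (Suc n)) * I (Suc n))"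
    then have "summable f" by (simp only: f_def[abs_def])
    then have sum2: "summable (\<lambda>n. f n + f (Suc n))" by (intro summable_add) (simp_all add: summable_Suc_iff)
    \<comment> \<open>Since consecutive weights have ratio tending to 1, \<open>h n\<close> and
      \<open>h (Suc n)\<close> can share the weight \<open>w n / 2\<close>; their sum then has the
      lower bound that neither has alone.\<close>
    have ev_w: "\<forall>\<^sub>F n in sequentially. w n / 2 \<le> w (Suc n)"
      unfolding w_def by real_asymp
    have f_bounds_Suc: "\<forall>\<^sub>F n in sequentially. a * (w (Suc n) * h (Suc n)) \<le> f (Suc n)"
      using f_bounds eventually_sequentially_Suc[of "\<lambda>n. a * (w n * h n) \<le> f n"]
      by (auto elim: eventually_mono)
    \<comment> \<open>The constant 1/4 instead of 1/2 absorbs the shift from n + 1 to n in the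
      power.\<close>
    have ev_r: "\<forall>\<^sub>F n in sequentially. a * c / 4 * real n powr (real p - 3 / 2 - D) \<le> a * (w n / 2 * (c / sqrt (real n)))"
      unfolding w_def using I(1) h(2) by real_asymp
    have "\<forall>\<^sub>F n in sequentially. norm (a * c / 4 * real n powr (real p - 3 / 2 - D)) \<le> f n + f (Suc n)"
      using f_bounds f_bounds_Suc h(4) ev_w ev_r
    proof eventually_elim
      case (elim n)
      have "a * (w n / 2 * (c / sqrt (real n))) \<le> a * (w n / 2 * (h n + h (Suc n)))"
        using elim I(1) w0[of n] by (intro mult_left_mono) auto
      also have "\<dots> = a * (w n / 2 * h n) + a * (w n / 2 * h (Suc n))" by (simp add: algebra_simps)
      also have "\<dots> \<le> a * (w n * h n) + a * (w (Suc n) * h (Suc n))"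
        using elim I(1) w0[of n] h(1) by (intro add_mono mult_left_mono mult_right_mono) auto
      also have "\<dots> \<le> f n + f (Suc n)" using elim by (intro add_mono) auto
      finally have "a * c / 4 * real n powr (real p - 3 / 2 - D) \<le> f n + f (Suc n)"
        using elim(5) by (rule order_trans[rotated])
      moreover have "a * c / 4 * real n powr (real p - 3 / 2 - D) \<ge> 0" using I(1) h(2) by simp
      ultimately show ?case by simp
    qed
    from summable_comparison_test_ev[OF this sum2]
    have "summable (\<lambda>n. real n powr (real p - 3 / 2 - D))"
      using I(1) h(2) by (subst (asm) summable_cmult_iff) auto
    then show "real p < D + 1 / 2" by (simp add: summable_real_powr_iff)
  qed
qed

theorem mainTheorem7:
  fixes M :: "'w measure"
    and B :: "real^'n \<Rightarrow> 'w \<Rightarrow> real"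
    and \<kappa> :: "real \<Rightarrow> real"
    and C\<^sub>1 C\<^sub>2 \<alpha> \<epsilon> u :: real
    and p :: nat
  assumes dim: "CARD('n) \<ge> 2"
    and gauss: "centered_gaussian_field M (sphere 0 1) B (\<lambda>x y. \<kappa> (x \<bullet> y))"
    and iso: "isotropic_field M B"
    and joint: "(\<lambda>(x, \<omega>). B x \<omega>) \<in> borel_measurable (restrict_space borel (sphere 0 1) \<Otimes>\<^sub>M M)"
    and cont: "continuous_on {-1..1} \<kappa>"
    and k1: "\<kappa> 1 = 1"
    and pos: "C\<^sub>1 > 0" "C\<^sub>2 > 0" "\<alpha> > 0" "\<epsilon> > 0"
    and lt1: "\<And>t. t \<in> {-1..1} \<Longrightarrow> t \<noteq> 1 \<Longrightarrow> \<bar>\<kappa> t\<bar> < 1"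
    and near: "\<And>\<theta>. \<bar>\<theta>\<bar> \<le> \<epsilon> \<Longrightarrow>
                 C\<^sub>1 * \<bar>\<theta>\<bar> powr \<alpha> \<le> 1 - \<kappa> (cos \<theta>) \<and> 1 - \<kappa> (cos \<theta>) \<le> C\<^sub>2 * \<bar>\<theta>\<bar> powr \<alpha>"
  shows "Y_in_Dp2 \<kappa> (sphere_measure :: (real^'n) measure) (indicator {u..}) p \<longleftrightarrow>
         real p < (real CARD('n) - 1) / \<alpha> + 1 / 2"
proof -
  let ?\<sigma> = "sphere_measure :: (real^'n) measure"
  define I where "I q = (\<integral>x. (\<integral>y. \<kappa> (x \<bullet> y) ^ q \<partial>?\<sigma>) \<partial>?\<sigma>)" for q
  define h where "h n = (hermite n u)\<^sup>2 / fact n" for n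
  obtain c where c: "c > 0"
    "\<And>x y :: real^'n. x \<in> sphere 0 1 \<Longrightarrow> y \<in> sphere 0 1 \<Longrightarrow> \<bar>\<kappa> (x \<bullet> y)\<bar> \<le> exp (- (c * dist x y powr \<alpha>))"
    using zonal_kernel_abs_le_exp[OF cont pos lt1 near] by blast
  have "\<exists>a b. a > 0 \<and> b > 0 \<and> (\<forall>\<^sub>F q in sequentially.
      a * real q powr - ((real DIM(real^'n) - 1) / \<alpha>) \<le> I q \<and>
      I q \<le> b * real q powr - ((real DIM(real^'n) - 1) / \<alpha>))"
    unfolding I_def
  proof (rule sphere_kernel_power_integral_asymp)
    show "1 - C\<^sub>2 * 2 powr \<alpha> * dist x y powr \<alpha> \<le> \<kappa> (x \<bullet> y)"
      if "x \<in> sphere 0 1" "y \<in> sphere 0 1" "dist x y \<le> \<epsilon> / 2" for x y :: "real^'n"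
      using near pos that by (intro zonal_kernel_ge) auto
  qed (use c pos cont borel_measurable_zonal_kernel in auto)
  then obtain a b where I: "a > 0" "b > 0" "\<forall>\<^sub>F q in sequentially.
      a * real q powr - ((real CARD('n) - 1) / \<alpha>) \<le> I q \<and> I q \<le> b * real q powr - ((real CARD('n) - 1) / \<alpha>)"
    by auto
  obtain c' C' where h: "c' > 0" "C' > 0" "\<forall>\<^sub>F n in sequentially.
      c' / sqrt (real n) \<le> h n + h (Suc n) \<and> h n + h (Suc n) \<le> C' / sqrt (real n)"
    using hermite_two_terms_asymp[of u] unfolding h_def by blast
  let ?t = "\<lambda>q. real q ^ p * fact q * (hermite_coeff q (indicator {u..}))\<^sup>2 * I q"
  \<comment> \<open>The coefficient formula starts at q = 1. The term q = 0, which need not vanish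
    when p = 0 because 0^0 = 1, is removed by an index shift that preserves summability.\<close>
  have "?t (Suc n) = (std_normal_density u)\<^sup>2 * (real (Suc n) ^ p * (h n / real (Suc n)) * I (Suc n))" for n
  proof -
    have "fact (Suc n) * (hermite_coeff (Suc n) (indicator {u..}))\<^sup>2 =
        (std_normal_density u)\<^sup>2 * ((hermite n u)\<^sup>2 / fact (Suc n))"
      unfolding hermite_coeff_indicator by (simp add: power_divide power_mult_distrib power2_eq_square del: fact_Suc)
    also have "(hermite n u)\<^sup>2 / fact (Suc n) = h n / real (Suc n)" by (simp add: h_def mult.commute)
    finally have *: "fact (Suc n) * (hermite_coeff (Suc n) (indicator {u..}))\<^sup>2 =
        (std_normal_density u)\<^sup>2 * (h n / real (Suc n))" .
    have "?t (Suc n) = real (Suc n) ^ p * (fact (Suc n) * (hermite_coeff (Suc n) (indicator {u..}))\<^sup>2) * I (Suc n)"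
      by (simp only: mult.assoc)
    then show ?thesis unfolding * by (simp only: mult_ac)
  qed
  then have "summable ?t \<longleftrightarrow>
      summable (\<lambda>n. (std_normal_density u)\<^sup>2 * (real (Suc n) ^ p * (h n / real (Suc n)) * I (Suc n)))"
    by (subst summable_Suc_iff[symmetric]) (simp only:)
  also have "\<dots> \<longleftrightarrow> summable (\<lambda>n. real (Suc n) ^ p * (h n / real (Suc n)) * I (Suc n))"
    using normal_density_pos[of 1 0 u] by (subst summable_cmult_iff) auto
  also have "\<dots> \<longleftrightarrow> real p < (real CARD('n) - 1) / \<alpha> + 1 / 2"
    by (rule summable_iff_two_terms_asymp[OF _ h I]) (simp add: h_def)
  finally show ?thesis by (simp add: Y_in_Dp2_def I_def)
qed

end
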